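(* Let $A_1,\dots,A_m\in\mathbb{R}^{2\times2}$ be such that $A_j+iI$ is invertible for each $j$ and $M(A_j)\cap M(A_k)=\{0\}$ for $j\neq k$. Assume that $\sigma(A_j)\subset\mathbb{C}\setminus\mathbb{R}$ for each $j$ and that $\det[A_j,A_k]=0$ for all $1\le j<k\le m$. For $j\ge1$ let $V_j=\left(|\lambda_j|^2-1,\,2\,\mathrm{Re}(\lambda_j)\right)\in\mathbb{R}^2$, where $\lambda_j\in\sigma(A_j)$, and let $V_0=(1,0)$. Then $M(A_1)\cup\dots\cup M(A_m)\cup\mathbb{R}^2$ allows Carleman approximation in $\mathbb{C}^2$ if and only if there is no pair $(j,k)$ with $0\le j<k\le m$ satisfying $V_j=cV_k$ for some $c>0$.
   Context: For $A\in\mathbb{R}^{2\times 2}$, $M(A):=(A+iI)\mathbb{R}^2\subset\mathbb{C}^2$, $\sigma(A)$ is the set of complex eigenvalues of $A$, and $[A,B]=AB-BA$. (Since the two eigenvalues of $A_j$ are complex conjugates, $V_j$ does not depend on the choice of $\lambda_j\in\sigma(A_j)$.) A closed set $S\subset\mathbb{C}^2$ allows Carleman approximation if for every continuous $f:S\to\mathbb{C}$ and every strictly positive continuous $\epsilon:S\to\mathbb{R}$ there is an entire function $g\in\mathcal{O}(\mathbb{C}^2)$ with $|f(z)-g(z)|<\epsilon(z)$ for all $z\in S$. *)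

theory Defs
  imports "HOL-Analysis.Analysis"
begin

definition cvec :: "real ^ 'n \<Rightarrow> complex ^ 'n" where
  "cvec x = (\<chi> i. complex_of_real (x $ i))"

abbreviation cmatrix :: "real ^ 'n ^ 'm \<Rightarrow> complex ^ 'n ^ 'm" where
  "cmatrix \<equiv> map_matrix complex_of_real"

(* mat \<i> is the scalar matrix iI *)
definition M :: "real ^ 2 ^ 2 \<Rightarrow> (complex ^ 2) set" where
  "M A = (\<lambda>x. (cmatrix A + mat \<i>) *v cvec x) ` UNIV"

definition spectrum :: "real ^ 'n ^ 'n \<Rightarrow> complex set" where
  "spectrum A = {\<mu>. \<exists>v. v \<noteq> 0 \<and> cmatrix A *v v = \<mu> *s v}"

definition commutator :: "real ^ 'n ^ 'n \<Rightarrow> real ^ 'n ^ 'n \<Rightarrow> real ^ 'n ^ 'n" where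
  "commutator A B = A ** B - B ** A"

(* Holomorphy in several variables: the real Frechet derivative exists everywhere
   and is complex-linear. The library's holomorphic_on covers one variable only. *)
definition entire :: "(complex ^ 'n \<Rightarrow> complex) \<Rightarrow> bool" where
  "entire g \<longleftrightarrow>
     (\<forall>z. \<exists>D. (g has_derivative D) (at z) \<and> Vector_Spaces.linear (*s) (*) D)"

definition allows_Carleman_approximation :: "(complex ^ 'n) set \<Rightarrow> bool" where
  "allows_Carleman_approximation S \<longleftrightarrow> closed S \<and>
     (\<forall>f :: complex ^ 'n \<Rightarrow> complex. \<forall>\<epsilon> :: complex ^ 'n \<Rightarrow> real.
        continuous_on S f \<longrightarrow> continuous_on S \<epsilon> \<longrightarrow> (\<forall>z\<in>S. 0 < \<epsilon> z) \<longrightarrow>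
        (\<exists>g. entire g \<and> (\<forall>z\<in>S. cmod (f z - g z) < \<epsilon> z)))"

definition V :: "(nat \<Rightarrow> complex) \<Rightarrow> nat \<Rightarrow> real ^ 2" where
  "V \<mu> j = (if j = 0 then vector [1, 0]
            else vector [(cmod (\<mu> j))\<^sup>2 - 1, 2 * Re (\<mu> j)])"

end

theory Submission
  imports Defs "HOL-Complex_Analysis.Complex_Residues"
begin

text \<open>
  Two real matrices of size two with singular commutator have a common complex eigenvector.
  As the eigenvalues are not real, its conjugate is a second one, so the matrices are
  diagonalised by common coordinates \<open>u = z\<^sub>1 + \<tau> z\<^sub>2\<close> and \<open>v = z\<^sub>1 + cnj \<tau> z\<^sub>2\<close>
  (\<open>eigenslope_common\<close>). In these coordinates the real plane is \<open>v = cnj u\<close>, and each \<open>M (A j)\<close> is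
  \<open>v = c\<^sub>j cnj u\<close>, where \<open>c\<^sub>j\<close>, read as a vector, is a positive multiple of \<open>V \<mu> j\<close>
  (\<open>M_eq_plane\<close>). The polynomial \<open>p = u v\<close> maps such a plane onto the ray through \<open>c\<^sub>j\<close>. The claim is
  therefore that Carleman approximation holds exactly when the rays are distinct.

  If two planes lie over the same ray, a curve \<open>p = d\<close> contains an annulus bounded by one circle in
  each plane. Mean values over the two circles agree for entire functions but not for
  continuous ones (\<open>not_Carleman_same_ray\<close>).

  Suppose that the rays are distinct. Differences of logarithms of \<open>1 - n p / \<alpha>\<close> separate the rays in
  the limit, hence a uniform limit of entire functions may be restricted to one plane and
  extended by \<open>0\<close> to the others, provided that it vanishes at the origin
  (\<open>approximable_restrict_plane\<close>). Since \<open>cnj u = v / c\<^sub>j\<close> on each plane, the conjugate coordinates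
  are uniform limits of entire functions on compact pieces of the union, and the theorem of
  Stone and Weierstrass gives density there (\<open>approximable_continuous\<close>). Multiplication by a rational
  cut-off in \<open>p\<close>, whose poles avoid the rays (\<open>cutoff\<close>), makes an approximation small on a large compact
  subset of the whole space (\<open>local_approximation\<close>). Correcting the error shell by shell then
  yields a locally uniformly convergent sequence of entire functions whose limit has the
  prescribed accuracy (\<open>Carleman_approximation\<close>).
\<close>

section \<open>Entire functions of several variables\<close>

lemma entire_continuous_on: "entire g \<Longrightarrow> continuous_on K g"
  unfolding entire_def
  by (meson continuous_at_imp_continuous_on has_derivative_continuous)

lemma entire_const [intro]: "entire (\<lambda>z. c)"
  unfolding entire_def
proof (intro allI exI conjI)
  show "((\<lambda>z. c) has_derivative (\<lambda>_. 0)) (at z)" for z :: "complex^'n" by simp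
  show "Vector_Spaces.linear (*s) (*) (\<lambda>_. 0)"
    by unfold_locales (auto simp: algebra_simps)
qed

lemma entire_nth [intro]:
  fixes i :: "'n::finite"
  shows "entire (\<lambda>z :: complex ^ 'n. z $ i)"
  unfolding entire_def
proof (intro allI exI conjI)
  show "((\<lambda>z. z $ i) has_derivative (\<lambda>z. z $ i)) (at z)" for z :: "complex ^ 'n"
    by (rule bounded_linear_imp_has_derivative) (rule bounded_linear_vec_nth)
  show "Vector_Spaces.linear (*s) (*) (\<lambda>z. z $ i)"
    by unfold_locales (auto simp: algebra_simps)
qed

lemma entire_add [intro]:
  assumes "entire f" "entire g" shows "entire (\<lambda>z. f z + g z)"
  unfolding entire_def
proof
  fix z
  obtain D E where D: "(f has_derivative D) (at z)" "Vector_Spaces.linear (*s) (*) D"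
    and E: "(g has_derivative E) (at z)" "Vector_Spaces.linear (*s) (*) E"
    using assms unfolding entire_def by metis
  interpret D: Vector_Spaces.linear "(*s)" "(*)" D by fact
  interpret E: Vector_Spaces.linear "(*s)" "(*)" E by fact
  show "\<exists>D. ((\<lambda>z. f z + g z) has_derivative D) (at z) \<and> Vector_Spaces.linear (*s) (*) D"
  proof (intro exI conjI)
    show "((\<lambda>z. f z + g z) has_derivative (\<lambda>h. D h + E h)) (at z)"
      using D E by (intro has_derivative_add)
    show "Vector_Spaces.linear (*s) (*) (\<lambda>h. D h + E h)"
      by unfold_locales (auto simp: D.add E.add D.scale E.scale algebra_simps)
  qed
qed

lemma entire_mult [intro]:
  assumes "entire f" "entire g" shows "entire (\<lambda>z. f z * g z)"
  unfolding entire_def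
proof
  fix z
  obtain D E where D: "(f has_derivative D) (at z)" "Vector_Spaces.linear (*s) (*) D"
    and E: "(g has_derivative E) (at z)" "Vector_Spaces.linear (*s) (*) E"
    using assms unfolding entire_def by metis
  interpret D: Vector_Spaces.linear "(*s)" "(*)" D by fact
  interpret E: Vector_Spaces.linear "(*s)" "(*)" E by fact
  show "\<exists>D. ((\<lambda>z. f z * g z) has_derivative D) (at z) \<and> Vector_Spaces.linear (*s) (*) D"
  proof (intro exI conjI)
    show "((\<lambda>z. f z * g z) has_derivative (\<lambda>h. f z * E h + D h * g z)) (at z)"
      using D E by (intro has_derivative_mult)
    show "Vector_Spaces.linear (*s) (*) (\<lambda>h. f z * E h + D h * g z)"
      by unfold_locales (auto simp: D.add E.add D.scale E.scale algebra_simps)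
  qed
qed

lemma entire_power [intro]: "entire f \<Longrightarrow> entire (\<lambda>z. f z ^ n)"
  by (induction n) auto

lemma entire_minus [intro]: "entire f \<Longrightarrow> entire (\<lambda>z. - f z)"
  using entire_mult[OF entire_const[of "-1"], of f] by simp

lemma entire_diff [intro]: "entire f \<Longrightarrow> entire g \<Longrightarrow> entire (\<lambda>z. f z - g z)"
  using entire_add[OF _ entire_minus, of f g] by simp

text \<open>Restricting an entire function to a holomorphic curve gives a holomorphic function of one
  variable; this is how one-variable complex analysis enters.\<close>

lemma entire_compose_curve:
  fixes \<gamma> :: "complex \<Rightarrow> complex ^ 'n"
  assumes "entire g" and D: "(g has_derivative D) (at (\<gamma> t))"
    and \<gamma>: "\<And>i. ((\<lambda>t. \<gamma> t $ i) has_field_derivative d $ i) (at t)"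
  shows "((\<lambda>t. g (\<gamma> t)) has_field_derivative D d) (at t)"
proof -
  obtain D' where D': "(g has_derivative D') (at (\<gamma> t))" "Vector_Spaces.linear (*s) (*) D'"
    using assms(1) unfolding entire_def by metis
  have [simp]: "D' = D" using D' D has_derivative_unique by blast
  interpret D: Vector_Spaces.linear "(*s)" "(*)" D using D' by simp
  have "(\<gamma> has_derivative (\<lambda>h. h *s d)) (at t)"
    unfolding has_derivative_componentwise_within[of \<gamma>]
  proof
    fix b :: "complex ^ 'n" assume "b \<in> Basis"
    then obtain i u where b: "b = axis i u" by (auto simp: Basis_vec_def)
    have "((\<lambda>t. \<gamma> t $ i) has_derivative (\<lambda>h. d $ i * h)) (at t)"
      using \<gamma>[of i] by (simp add: has_field_derivative_def)
    hence "((\<lambda>t. \<gamma> t $ i \<bullet> u) has_derivative (\<lambda>h. (d $ i * h) \<bullet> u)) (at t)"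
      by (rule has_derivative_inner_left)
    thus "((\<lambda>x. \<gamma> x \<bullet> b) has_derivative (\<lambda>x. (x *s d) \<bullet> b)) (at t)"
      by (simp add: b inner_axis mult.commute)
  qed
  from has_derivative_compose[OF this D]
  have "((\<lambda>x. g (\<gamma> x)) has_derivative (\<lambda>x. D (x *s d))) (at t)" .
  thus ?thesis by (simp add: has_field_derivative_def D.scale mult_commute_abs)
qed

text \<open>Applying the one-variable Cauchy estimate on the complex line through \<open>z\<close> in direction \<open>v\<close>,
  on the disc that stays within distance \<open>1\<close> of \<open>z\<close>, bounds the whole derivative at once.\<close>

lemma entire_derivative_bound:
  fixes g :: "complex ^ 'n \<Rightarrow> complex"
  assumes "entire g" and D: "(g has_derivative D) (at z)"
    and B: "\<And>y. norm (y - z) \<le> 1 \<Longrightarrow> cmod (g y) \<le> B"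
  shows "cmod (D v) \<le> B * norm v"
proof (cases "v = 0")
  case True
  then show ?thesis using has_derivative_bounded_linear[OF D] linear_0 bounded_linear.linear
    by fastforce
next
  case False
  define \<gamma> where "\<gamma> = (\<lambda>t. z + t *s v)"
  have nsv: "norm (t *s v) = cmod t * norm v" for t
    by (simp add: norm_vec_def L2_set_def norm_mult power_mult_distrib real_sqrt_mult
        flip: sum_distrib_left)
  have dv: "((\<lambda>t. g (\<gamma> t)) has_field_derivative D' v) (at t)"
    if "(g has_derivative D') (at (\<gamma> t))" for D' t
    using assms(1) that
    by (rule entire_compose_curve) (auto simp: \<gamma>_def intro!: derivative_eq_intros)
  have hol: "(\<lambda>t. g (\<gamma> t)) holomorphic_on UNIV"
    using dv assms(1) unfolding entire_def holomorphic_on_def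
    by (metis field_differentiable_def UNIV_I field_differentiable_at_within)
  have "cmod ((deriv ^^ 1) (\<lambda>t. g (\<gamma> t)) 0) \<le> fact 1 * B / (1 / norm v) ^ 1"
  proof (rule Cauchy_inequality)
    show "(\<lambda>t. g (\<gamma> t)) holomorphic_on ball 0 (1 / norm v)"
      using hol holomorphic_on_subset by blast
    show "continuous_on (cball 0 (1 / norm v)) (\<lambda>t. g (\<gamma> t))"
      using hol holomorphic_on_imp_continuous_on continuous_on_subset by blast
    show "cmod (g (\<gamma> x)) \<le> B" if "cmod (0 - x) = 1 / norm v" for x
      using that False by (intro B) (simp add: \<gamma>_def nsv)
  qed (use False in auto)
  moreover have "deriv (\<lambda>t. g (\<gamma> t)) 0 = D v"
    using dv[of D 0] D by (intro DERIV_imp_deriv) (simp add: \<gamma>_def)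
  ultimately show ?thesis by simp
qed

text \<open>By the Cauchy estimates, locally uniform convergence of entire functions carries over to
  their derivatives, so the limit is again entire.\<close>

lemma entire_limit:
  fixes G :: "nat \<Rightarrow> complex ^ 'n \<Rightarrow> complex"
  assumes ent: "\<And>l. entire (G l)"
    and conv: "\<And>R. \<exists>N. \<forall>l\<ge>N. \<forall>z. norm z \<le> R \<longrightarrow> cmod (G (Suc l) z - G l z) \<le> (1/2) ^ l"
  shows "\<exists>g. entire g \<and> (\<forall>z. (\<lambda>l. G l z) \<longlonglongrightarrow> g z)"
proof -
  obtain D where D: "\<And>l z. (G l has_derivative D l z) (at z)"
    "\<And>l z. Vector_Spaces.linear (*s) (*) (D l z)"
    using ent unfolding entire_def by metis
  have tail: "dist (G m z) (G n z) \<le> 2 * (1/2) ^ N"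
    if N: "\<And>l z. l \<ge> N \<Longrightarrow> norm z \<le> R \<Longrightarrow> cmod (G (Suc l) z - G l z) \<le> (1/2) ^ l"
      and z: "norm z \<le> R" and mn: "N \<le> n" "n \<le> m" for N R m n z
  proof -
    have "cmod (G m z - G n z) \<le> 2 * (1/2) ^ n - 2 * (1/2) ^ m"
      using mn(2)
    proof (induction m rule: dec_induct)
      case (step k)
      have "cmod (G (Suc k) z - G n z) \<le> cmod (G (Suc k) z - G k z) + cmod (G k z - G n z)"
        using norm_triangle_ineq[of "G (Suc k) z - G k z" "G k z - G n z"] by simp
      also have "\<dots> \<le> (1/2) ^ k + (2 * (1/2) ^ n - 2 * (1/2) ^ k)"
        using step mn N[of k z] z by simp
      finally show ?case by simp
    qed auto
    also have "\<dots> \<le> 2 * (1/2) ^ n" by simp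
    also have "\<dots> \<le> 2 * (1/2) ^ N" using mn by (simp add: power_decreasing)
    finally show ?thesis by (simp add: dist_norm)
  qed
  have small: "\<exists>N0\<ge>N. 2 * (1/2::real) ^ N0 < e" if "e > 0" for e N
  proof -
    have "(\<lambda>n. 2 * (1/2::real) ^ n) \<longlonglongrightarrow> 0" by real_asymp
    hence "\<forall>\<^sub>F n in sequentially. 2 * (1/2::real) ^ n < e" using that by (rule order_tendstoD)
    with eventually_ge_at_top[of N] have "\<forall>\<^sub>F n in sequentially. n \<ge> N \<and> 2 * (1/2::real) ^ n < e"
      by eventually_elim auto
    thus ?thesis unfolding eventually_sequentially by blast
  qed
  have ucauchy: "\<exists>N. \<forall>m\<ge>N. \<forall>n\<ge>N. \<forall>z. norm z \<le> R \<longrightarrow> dist (G m z) (G n z) < e" if "e > 0" for R e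
  proof -
    obtain N0 where N0: "\<And>l z. l \<ge> N0 \<Longrightarrow> norm z \<le> R \<Longrightarrow> cmod (G (Suc l) z - G l z) \<le> (1/2) ^ l"
      using conv by blast
    obtain N where N: "N \<ge> N0" "2 * (1/2::real) ^ N < e" using small \<open>e > 0\<close> by blast
    have "dist (G m z) (G n z) < e" if "m \<ge> N" "n \<ge> N" "norm z \<le> R" for m n z
      using tail[of N R z n m] tail[of N R z m n] N0 N that
      by (cases "n \<le> m") (auto simp: dist_commute)
    thus ?thesis by blast
  qed
  have "\<exists>l. (\<lambda>n. G n z) \<longlonglongrightarrow> l" for z
    using ucauchy
    by (intro Cauchy_convergent[unfolded convergent_def] metric_CauchyI) blast
  then obtain g where g: "\<And>z. (\<lambda>l. G l z) \<longlonglongrightarrow> g z" by metis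
  have Dc: "cmod (D m z v - D n z v) \<le> e * norm v"
    if "\<And>y. norm (y - z) \<le> 1 \<Longrightarrow> cmod (G m y - G n y) \<le> e" for m n z v e
    using entire_derivative_bound[OF entire_diff[OF ent ent] has_derivative_diff[OF D(1) D(1)] that]
    by blast
  have DC: "\<exists>N. \<forall>m\<ge>N. \<forall>n\<ge>N. \<forall>z. norm z \<le> R \<longrightarrow> (\<forall>v. cmod (D m z v - D n z v) \<le> e * norm v)"
    if "e > 0" for R e
  proof -
    obtain N where N: "\<And>m n z. m\<ge>N \<Longrightarrow> n\<ge>N \<Longrightarrow> norm z \<le> R + 1 \<Longrightarrow> dist (G m z) (G n z) < e"
      using ucauchy[OF \<open>e > 0\<close>] by metis
    have "cmod (D m z v - D n z v) \<le> e * norm v" if "m \<ge> N" "n \<ge> N" "norm z \<le> R" for m n z v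
    proof (rule Dc)
      fix y assume "norm (y - z) \<le> 1"
      hence "norm y \<le> R + 1" using that norm_triangle_ineq[of z "y - z"] by simp
      thus "cmod (G m y - G n y) \<le> e" using N[of m n y] that by (simp add: dist_norm)
    qed
    thus ?thesis by blast
  qed
  have "entire g"
    unfolding entire_def
  proof
    fix z0 :: "complex ^ 'n"
    define R where "R = norm z0 + 1"
    have DCv: "\<exists>l. (\<lambda>n. D n z v) \<longlonglongrightarrow> l" for z v
    proof (intro Cauchy_convergent[unfolded convergent_def] metric_CauchyI)
      fix e :: real assume "e > 0"
      hence "e / (norm v + 1) > 0" by (simp add: add_nonneg_pos)
      then obtain N where N: "\<And>m n. m\<ge>N \<Longrightarrow> n\<ge>N \<Longrightarrow>
          cmod (D m z v - D n z v) \<le> e / (norm v + 1) * norm v"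
        using DC[of "e / (norm v + 1)" "norm z"] by blast
      have "norm v + 1 > 0" using norm_ge_zero[of v] by linarith
      hence "e / (norm v + 1) * norm v < e"
        using \<open>e > 0\<close> by (simp add: pos_divide_less_eq algebra_simps)
      thus "\<exists>M. \<forall>m\<ge>M. \<forall>n\<ge>M. dist (D m z v) (D n z v) < e"
        using N by (force simp: dist_norm)
    qed
    then obtain D' where D': "\<And>z v. (\<lambda>n. D n z v) \<longlonglongrightarrow> D' z v" by metis
    have "\<exists>g. \<forall>x\<in>cball 0 R. (\<lambda>n. G n x) \<longlonglongrightarrow> g x \<and> (g has_derivative D' x) (at x within cball 0 R)"
    proof (rule has_derivative_sequence)
      show "(G n has_derivative D n x) (at x within cball 0 R)" for n x
        using D has_derivative_at_withinI by blast
      show "\<forall>\<^sub>F n in sequentially. \<forall>x\<in>cball 0 R. \<forall>h. cmod (D n x h - D' x h) \<le> e * norm h"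
        if e: "e > 0" for e
      proof -
        obtain N where N: "\<And>m n z v. m\<ge>N \<Longrightarrow> n\<ge>N \<Longrightarrow> norm z \<le> R \<Longrightarrow>
            cmod (D m z v - D n z v) \<le> e * norm v" using DC[OF e, of R] by blast
        have "cmod (D n x h - D' x h) \<le> e * norm h" if "n \<ge> N" "norm x \<le> R" for n x h
        proof (rule LIMSEQ_le_const2)
          show "(\<lambda>m. cmod (D n x h - D m x h)) \<longlonglongrightarrow> cmod (D n x h - D' x h)"
            by (intro tendsto_intros D')
          show "\<exists>N. \<forall>m\<ge>N. cmod (D n x h - D m x h) \<le> e * norm h" using N that by blast
        qed
        thus ?thesis unfolding eventually_sequentially by (intro exI[of _ N]) (simp add: dist_norm)
      qed
      show "0 \<in> cball (0::complex^'n) R" by (simp add: R_def)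
    qed (use g in auto)
    then obtain g' where g': "\<And>x. norm x \<le> R \<Longrightarrow> (\<lambda>n. G n x) \<longlonglongrightarrow> g' x"
        "\<And>x. norm x \<le> R \<Longrightarrow> (g' has_derivative D' x) (at x within cball 0 R)"
      by (metis mem_cball_0)
    have eq: "g' x = g x" if "norm x \<le> R" for x using g' g that LIMSEQ_unique by blast
    have "(g has_derivative D' z0) (at z0 within cball 0 R)"
      by (rule has_derivative_transform[OF _ _ g'(2)]) (auto simp: R_def eq)
    moreover have "z0 \<in> interior (cball 0 R)" by (simp add: R_def)
    ultimately have "(g has_derivative D' z0) (at z0)" by (simp only: at_within_interior)
    moreover have "Vector_Spaces.linear (*s) (*) (D' z0)"
    proof unfold_locales
      show "D' z0 (x + y) = D' z0 x + D' z0 y" for x y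
      proof (rule LIMSEQ_unique[OF D'])
        interpret L: Vector_Spaces.linear "(*s)" "(*)" "D n z0" for n by (rule D)
        show "(\<lambda>n. D n z0 (x + y)) \<longlonglongrightarrow> D' z0 x + D' z0 y"
          unfolding L.add by (intro tendsto_intros D')
      qed
      show "D' z0 (r *s x) = r * D' z0 x" for r x
      proof (rule LIMSEQ_unique[OF D'])
        interpret L: Vector_Spaces.linear "(*s)" "(*)" "D n z0" for n by (rule D)
        show "(\<lambda>n. D n z0 (r *s x)) \<longlonglongrightarrow> r * D' z0 x"
          unfolding L.scale by (intro tendsto_intros D')
      qed
    qed
    ultimately show "\<exists>D. (g has_derivative D) (at z0) \<and> Vector_Spaces.linear (*s) (*) D" by blast
  qed
  thus ?thesis using g by blast
qed

section \<open>Uniform approximation on compact sets\<close>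

text \<open>For compact \<open>K\<close> these functions form a uniformly closed algebra, so approximability can be shown by
  algebraic operations and uniform limits, without naming the approximating functions.\<close>

definition approximable :: "(complex ^ 'n) set \<Rightarrow> (complex ^ 'n \<Rightarrow> complex) \<Rightarrow> bool" where
  "approximable K f \<longleftrightarrow> (\<forall>e>0. \<exists>g. entire g \<and> (\<forall>z\<in>K. cmod (g z - f z) < e))"

lemma approximableE:
  assumes "approximable K f" "e > 0"
  obtains g where "entire g" "\<And>z. z \<in> K \<Longrightarrow> cmod (g z - f z) < e"
  using assms unfolding approximable_def by metis

lemma approximable_entire: "entire f \<Longrightarrow> approximable K f"
  unfolding approximable_def by (intro allI impI exI[of _ f]) auto

lemma approximable_const: "approximable K (\<lambda>z. c)"
  by (intro approximable_entire entire_const)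

lemma approximable_cong: "approximable K f \<Longrightarrow> (\<And>z. z \<in> K \<Longrightarrow> f z = g z) \<Longrightarrow> approximable K g"
  unfolding approximable_def by metis

lemma approximable_limit:
  assumes "\<And>e. e > 0 \<Longrightarrow> \<exists>g. approximable K g \<and> (\<forall>z\<in>K. cmod (g z - f z) \<le> e)"
  shows "approximable K f"
  unfolding approximable_def
proof (intro allI impI)
  fix e :: real assume "e > 0"
  then obtain g where g: "approximable K g" "\<And>z. z\<in>K \<Longrightarrow> cmod (g z - f z) \<le> e / 2"
    using assms[of "e/2"] by auto
  obtain h where h: "entire h" "\<And>z. z\<in>K \<Longrightarrow> cmod (h z - g z) < e / 2"
    using g(1) \<open>e > 0\<close> unfolding approximable_def by (metis half_gt_zero)
  have "cmod (h z - f z) < e" if "z \<in> K" for z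
    using norm_triangle_ineq[of "h z - g z" "g z - f z"] g(2)[OF that] h(2)[OF that] by simp
  thus "\<exists>g. entire g \<and> (\<forall>z\<in>K. cmod (g z - f z) < e)" using h by blast
qed

lemma approximable_imp_continuous_on:
  assumes "approximable K f" shows "continuous_on K f"
proof -
  have "\<exists>g. entire g \<and> (\<forall>z\<in>K. cmod (g z - f z) < inverse (Suc n))" for n
    using assms unfolding approximable_def by (metis inverse_Suc)
  then obtain g where g: "\<And>n. entire (g n)" "\<And>n z. z\<in>K \<Longrightarrow> cmod (g n z - f z) < inverse (Suc n)"
    by metis
  have "uniform_limit K g f sequentially"
    unfolding uniform_limit_iff
  proof (intro allI impI)
    fix e :: real assume "e > 0"
    then obtain N where N: "inverse (real (Suc N)) < e" using reals_Archimedean by blast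
    have "dist (g n z) (f z) < e" if "n \<ge> N" "z \<in> K" for n z
    proof -
      have "inverse (real (Suc n)) \<le> inverse (real (Suc N))" using that by simp
      thus ?thesis using g(2)[OF that(2), of n] N unfolding dist_norm by linarith
    qed
    thus "\<forall>\<^sub>F n in sequentially. \<forall>x\<in>K. dist (g n x) (f x) < e"
      unfolding eventually_sequentially by blast
  qed
  thus ?thesis
    by (rule uniform_limit_theorem[rotated]) (auto intro!: always_eventually entire_continuous_on g)
qed

lemma approximable_bounded:
  assumes K: "compact K" and f: "approximable K f"
  obtains B where "B > 0" "\<And>z. z \<in> K \<Longrightarrow> cmod (f z) \<le> B"
proof -
  obtain g where g: "entire g" "\<And>z. z\<in>K \<Longrightarrow> cmod (g z - f z) < 1"
    using f unfolding approximable_def by (metis zero_less_one)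
  have "bounded (g ` K)"
    using K g(1) entire_continuous_on compact_continuous_image compact_imp_bounded by metis
  then obtain B where B: "B > 0" "\<And>z. z \<in> K \<Longrightarrow> cmod (g z) \<le> B"
    unfolding bounded_pos by auto
  have "cmod (f z) \<le> B + 1" if "z \<in> K" for z
    using norm_triangle_ineq2[of "f z" "g z"] g(2)[OF that] B(2)[OF that]
    by (simp add: norm_minus_commute)
  thus ?thesis using that[of "B + 1"] B(1) by auto
qed

lemma approximable_add:
  assumes "approximable K f" "approximable K g"
  shows "approximable K (\<lambda>z. f z + g z)"
  unfolding approximable_def
proof (intro allI impI)
  fix e :: real assume "e > 0"
  obtain f' where f': "entire f'" "\<And>z. z\<in>K \<Longrightarrow> cmod (f' z - f z) < e / 2"
    using assms(1) \<open>e > 0\<close> unfolding approximable_def by (metis half_gt_zero)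
  obtain g' where g': "entire g'" "\<And>z. z\<in>K \<Longrightarrow> cmod (g' z - g z) < e / 2"
    using assms(2) \<open>e > 0\<close> unfolding approximable_def by (metis half_gt_zero)
  have "cmod (f' z + g' z - (f z + g z)) < e" if "z \<in> K" for z
    using norm_triangle_ineq[of "f' z - f z" "g' z - g z"] f'(2)[OF that] g'(2)[OF that]
    by (simp add: algebra_simps)
  thus "\<exists>h. entire h \<and> (\<forall>z\<in>K. cmod (h z - (f z + g z)) < e)" using f' g' entire_add by blast
qed

lemma approximable_mult:
  assumes K: "compact K" and f: "approximable K f" and g: "approximable K g"
  shows "approximable K (\<lambda>z. f z * g z)"
  unfolding approximable_def
proof (intro allI impI)
  fix e :: real assume "e > 0"
  obtain B where B: "B > 0" "\<And>z. z \<in> K \<Longrightarrow> cmod (f z) \<le> B" using approximable_bounded[OF K f] by blast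
  have eB: "e / (2 * B) > 0" using B \<open>e > 0\<close> by simp
  obtain g' where g': "entire g'" "\<And>z. z\<in>K \<Longrightarrow> cmod (g' z - g z) < e / (2 * B)"
    using g eB unfolding approximable_def by metis
  obtain C where C: "C > 0" "\<And>z. z \<in> K \<Longrightarrow> cmod (g' z) \<le> C"
    using approximable_bounded[OF K approximable_entire[OF g'(1)]] by blast
  have eC: "e / (2 * C) > 0" using C \<open>e > 0\<close> by simp
  obtain f' where f': "entire f'" "\<And>z. z\<in>K \<Longrightarrow> cmod (f' z - f z) < e / (2 * C)"
    using f eC unfolding approximable_def by metis
  have "cmod (f' z * g' z - f z * g z) < e" if z: "z \<in> K" for z
  proof -
    have "f' z * g' z - f z * g z = (f' z - f z) * g' z + f z * (g' z - g z)"
      by (simp add: algebra_simps)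
    hence "cmod (f' z * g' z - f z * g z) \<le>
        cmod (f' z - f z) * cmod (g' z) + cmod (f z) * cmod (g' z - g z)"
      by (metis norm_mult norm_triangle_ineq)
    also have "\<dots> \<le> cmod (f' z - f z) * C + B * cmod (g' z - g z)"
      using B C z by (intro add_mono mult_mono) auto
    also have "\<dots> < e / (2 * C) * C + B * (e / (2 * B))"
      using B C f' g' z by (intro add_strict_mono mult_strict_right_mono mult_strict_left_mono) auto
    also have "\<dots> = e" using B C by simp
    finally show ?thesis .
  qed
  thus "\<exists>h. entire h \<and> (\<forall>z\<in>K. cmod (h z - f z * g z) < e)" using f' g' entire_mult by blast
qed

lemma approximable_cmult: "approximable K f \<Longrightarrow> approximable K (\<lambda>z. c * f z)"
proof (cases "c = 0")
  case False
  assume f: "approximable K f"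
  show ?thesis
    unfolding approximable_def
  proof (intro allI impI)
    fix e :: real assume "e > 0"
    hence "e / cmod c > 0" using False by simp
    then obtain f' where f': "entire f'" "\<And>z. z\<in>K \<Longrightarrow> cmod (f' z - f z) < e / cmod c"
      using f unfolding approximable_def by metis
    have "cmod (c * f' z - c * f z) < e" if "z \<in> K" for z
      using f'(2)[OF that] False
      by (simp add: pos_less_divide_eq norm_mult mult.commute flip: right_diff_distrib)
    moreover have "entire (\<lambda>z. c * f' z)" using f'(1) by (intro entire_mult entire_const)
    ultimately show "\<exists>h. entire h \<and> (\<forall>z\<in>K. cmod (h z - c * f z) < e)" by blast
  qed
qed (simp add: approximable_const)

lemma approximable_diff:
  assumes "approximable K f" "approximable K g"
  shows "approximable K (\<lambda>z. f z - g z)"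
  using approximable_add[OF assms(1) approximable_cmult[OF assms(2), of "-1"]] by simp

lemma approximable_power:
  "compact K \<Longrightarrow> approximable K f \<Longrightarrow> approximable K (\<lambda>z. f z ^ n)"
  by (induction n) (auto intro: approximable_const approximable_mult)

lemma approximable_sum:
  "(\<And>i. i \<in> I \<Longrightarrow> approximable K (f i)) \<Longrightarrow> approximable K (\<lambda>z. \<Sum>i\<in>I. f i z)"
  by (induction I rule: infinite_finite_induct) (auto intro: approximable_const approximable_add)

text \<open>On \<open>K\<close> the geometric series converges uniformly, so its sum stays in the algebra.\<close>

lemma approximable_geometric:
  assumes K: "compact K" and f: "approximable K f" and half: "\<And>z. z \<in> K \<Longrightarrow> cmod (f z) \<le> 1/2"
  shows "approximable K (\<lambda>z. 1 / (1 - f z))"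
proof (rule approximable_limit)
  fix e :: real assume "e > 0"
  have "(\<lambda>n. 2 * (1/2::real) ^ n) \<longlonglongrightarrow> 0" by real_asymp
  hence "\<forall>\<^sub>F n in sequentially. 2 * (1/2::real) ^ n < e" using \<open>e > 0\<close> by (rule order_tendstoD)
  then obtain n where n: "2 * (1/2::real) ^ n < e" unfolding eventually_sequentially by blast
  have "cmod ((\<Sum>i<n. f z ^ i) - 1 / (1 - f z)) \<le> e" if z: "z \<in> K" for z
  proof -
    have "1/2 \<le> cmod (1 - f z)" using half[OF z] norm_triangle_ineq2[of 1 "f z"] by simp
    moreover from this have "f z \<noteq> 1" by auto
    moreover from this have "(\<Sum>i<n. f z ^ i) - 1 / (1 - f z) = - (f z ^ n) / (1 - f z)"
      by (simp add: sum_gp_strict diff_divide_distrib)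
    moreover have "cmod (f z) ^ n \<le> (1/2) ^ n" using half[OF z] by (intro power_mono) auto
    ultimately have "cmod ((\<Sum>i<n. f z ^ i) - 1 / (1 - f z)) \<le> (1/2) ^ n / (1/2)"
      by (simp only: norm_divide norm_minus_cancel norm_power) (intro frac_le, auto)
    thus ?thesis using n by simp
  qed
  moreover have "approximable K (\<lambda>z. \<Sum>i<n. f z ^ i)"
    by (intro approximable_sum approximable_power K f)
  ultimately show "\<exists>g. approximable K g \<and> (\<forall>z\<in>K. cmod (g z - 1 / (1 - f z)) \<le> e)" by blast
qed

text \<open>Pole pushing: \<open>1 / (1 - s f)\<close> is approximable for small \<open>s\<close> by the geometric series, and
  approximability propagates from \<open>s\<close> to \<open>s + h\<close> for steps \<open>h\<close> whose size depends only on \<open>d\<close>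
  and on a bound for \<open>f\<close>.\<close>

lemma approximable_inverse:
  assumes K: "compact K" and f: "approximable K f" and "d > 0"
    and d: "\<And>z s. z \<in> K \<Longrightarrow> 0 \<le> s \<Longrightarrow> s \<le> 1 \<Longrightarrow> d \<le> cmod (1 - of_real s * f z)"
    and s01: "0 \<le> s" "s \<le> 1"
  shows "approximable K (\<lambda>z. 1 / (1 - of_real s * f z))"
proof -
  obtain B where B: "B > 0" "\<And>z. z \<in> K \<Longrightarrow> cmod (f z) \<le> B" using approximable_bounded[OF K f] by blast
  obtain N :: nat where N: "real N > 2 * B / d" using reals_Archimedean2 by blast
  have "2 * B / d > 0" using B \<open>d > 0\<close> by simp
  hence "N > 0" using N by (cases N) auto
  define h where "h = s / real N"
  have h: "h \<ge> 0" "real N * h = s" using s01 \<open>N > 0\<close> by (auto simp: h_def)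
  have hB: "h * B / d \<le> 1/2"
  proof -
    have "h * B \<le> 1 / real N * B" using s01 B by (simp add: h_def divide_simps)
    also have "\<dots> \<le> d / 2" using N \<open>d > 0\<close> \<open>N > 0\<close> by (simp add: field_simps)
    finally show ?thesis using \<open>d > 0\<close> by (simp add: field_simps)
  qed
  have "approximable K (\<lambda>z. 1 / (1 - of_real (real k * h) * f z))" if "k \<le> N" for k
    using that
  proof (induction k)
    case 0
    show ?case using approximable_const[of K 1] by simp
  next
    case (Suc k)
    define g where "g = (\<lambda>z. 1 / (1 - of_real (real k * h) * f z))"
    have "real k * h \<le> real N * h" using h Suc.prems by (intro mult_right_mono) auto
    hence kh: "0 \<le> real k * h" "real k * h \<le> 1" using h s01 by auto
    have dk: "d \<le> cmod (1 - of_real (real k * h) * f z)" if "z \<in> K" for z using d[OF that kh] .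
    have g: "approximable K g" using Suc by (simp add: g_def)
    have x: "approximable K (\<lambda>z. of_real h * (f z * g z))"
      by (intro approximable_cmult approximable_mult K f g)
    have "cmod (of_real h * (f z * g z)) \<le> 1/2" if "z \<in> K" for z
    proof -
      have "cmod (g z) \<le> 1 / d"
        using dk[OF that] \<open>d > 0\<close> by (simp only: g_def norm_divide norm_one) (intro frac_le, auto)
      hence "cmod (f z) * cmod (g z) \<le> B * (1 / d)" using B that by (intro mult_mono) auto
      hence "h * (cmod (f z) * cmod (g z)) \<le> h * (B * (1 / d))" using h by (intro mult_left_mono)
      also have "\<dots> \<le> 1 / 2" using hB by simp
      finally show ?thesis using h by (simp add: norm_mult)
    qed
    note approximable_mult[OF K g approximable_geometric[OF K x this]]
    moreover have "g z * (1 / (1 - of_real h * (f z * g z))) = 1 / (1 - of_real (real (Suc k) * h) * f z)"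
      if "z \<in> K" for z
    proof -
      have "1 - of_real (real k * h) * f z \<noteq> 0" using dk[OF that] \<open>d > 0\<close> by auto
      hence "1 - of_real h * (f z * g z) =
          (1 - of_real (real (Suc k) * h) * f z) / (1 - of_real (real k * h) * f z)"
        by (simp add: g_def field_simps)
      thus ?thesis using \<open>1 - of_real (real k * h) * f z \<noteq> 0\<close> by (simp add: g_def)
    qed
    ultimately show ?case by (rule approximable_cong)
  qed
  from this[of N] show ?thesis using h by simp
qed

text \<open>The principal logarithm of \<open>1 - f\<close> is the integral of \<open>- f / (1 - s f)\<close> over
  \<open>0 \<le> s \<le> 1\<close>; the approximants are its Riemann sums.\<close>

lemma approximable_Ln:
  assumes K: "compact K" and f: "approximable K f" and "d > 0"
    and d: "\<And>z s. z \<in> K \<Longrightarrow> 0 \<le> s \<Longrightarrow> s \<le> 1 \<Longrightarrow> d \<le> cmod (1 - of_real s * f z)"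
  shows "approximable K (\<lambda>z. Ln (1 - f z))"
proof (rule approximable_limit)
  fix e :: real assume "e > 0"
  obtain B where B: "B > 0" "\<And>z. z \<in> K \<Longrightarrow> cmod (f z) \<le> B" using approximable_bounded[OF K f] by blast
  define C where "C = (B / d)\<^sup>2"
  obtain N :: nat where N: "real N > C / e" using reals_Archimedean2 by blast
  have "C / e > 0" using B \<open>d > 0\<close> \<open>e > 0\<close> by (simp add: C_def)
  hence "N > 0" using N by (cases N) auto
  define a where "a = (\<lambda>k::nat. real k / real N)"
  have a: "0 \<le> a k" "k \<le> N \<Longrightarrow> a k \<le> 1" "a (Suc k) - a k = 1 / real N" for k
    using \<open>N > 0\<close> by (auto simp: a_def field_simps)
  define R where "R = (\<lambda>z. \<Sum>k<N. - 1 / of_nat N * (f z * (1 / (1 - of_real (a k) * f z))))"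
  have "approximable K R"
    unfolding R_def
    by (intro approximable_sum approximable_cmult approximable_mult K f
        approximable_inverse[OF K f \<open>d > 0\<close> d]) (use a in auto)
  moreover have "cmod (R z - Ln (1 - f z)) \<le> e" if z: "z \<in> K" for z
  proof -
    define \<phi> where "\<phi> = (\<lambda>i::nat. \<lambda>s::complex. if i = 0 then Ln (1 - s * f z)
        else if i = 1 then - f z / (1 - s * f z) else - (f z / (1 - s * f z))\<^sup>2)"
    define S where "S = complex_of_real ` {0..1}"
    have "convex S" unfolding S_def
      by (intro convex_linear_image) (auto simp: linear_of_real)
    have nz: "1 - s * f z \<noteq> 0" if "s \<in> S" for s
      using d[OF z] \<open>d > 0\<close> that by (force simp: S_def)
    (* A value x <= 0 at s would give the value 0 at the smaller parameter s / (1 - x). *)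
    have np: "1 - s * f z \<notin> \<real>\<^sub>\<le>\<^sub>0" if s: "s \<in> S" for s
    proof
      assume "1 - s * f z \<in> \<real>\<^sub>\<le>\<^sub>0"
      then obtain x where x: "1 - s * f z = of_real x" "x \<le> 0" by (auto elim: nonpos_Reals_cases)
      obtain r where r: "s = of_real r" "0 \<le> r" "r \<le> 1" using s by (auto simp: S_def)
      have "s * f z = of_real (1 - x)" using x by (simp add: algebra_simps)
      hence "of_real (r / (1 - x)) * f z = 1" using x r by (simp add: divide_simps)
      moreover have "0 \<le> r / (1 - x)" "r / (1 - x) \<le> 1" using r x by auto
      ultimately show False using d[OF z, of "r / (1 - x)"] \<open>d > 0\<close> by simp
    qed
    have bound: "cmod (\<phi> 0 t - (\<Sum>i\<le>1. \<phi> i s * (t - s) ^ i / fact i)) \<le> C * cmod (t - s) ^ Suc 1 / fact 1"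
      if "s \<in> S" "t \<in> S" for s t
    proof (rule field_Taylor[OF \<open>convex S\<close>])
      fix i x assume x: "x \<in> S" and i: "i \<le> (1::nat)"
      have "(\<phi> 0 has_field_derivative \<phi> 1 x) (at x within S)"
        using np[OF x] unfolding \<phi>_def
        by (auto intro!: derivative_eq_intros simp: field_simps)
      moreover have "(\<phi> 1 has_field_derivative \<phi> 2 x) (at x within S)"
        using nz[OF x] unfolding \<phi>_def
        by (auto intro!: derivative_eq_intros simp: power2_eq_square)
      ultimately show "(\<phi> i has_field_derivative \<phi> (Suc i) x) (at x within S)"
        using i by (cases i) (auto simp: numeral_2_eq_2)
    next
      fix x assume x: "x \<in> S"
      have "cmod (f z) / cmod (1 - x * f z) \<le> B / d"
        using x B z d[OF z] \<open>d > 0\<close> by (intro frac_le) (auto simp: S_def)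
      thus "cmod (\<phi> (Suc 1) x) \<le> C"
        by (simp add: \<phi>_def C_def norm_power norm_divide power_mono)
    qed (use that in auto)
    have step: "cmod (\<phi> 0 (a (Suc k)) - \<phi> 0 (a k) - \<phi> 1 (a k) / of_nat N) \<le> C / (real N)\<^sup>2"
      if "k < N" for k
    proof -
      have "complex_of_real (a k) \<in> S" "complex_of_real (a (Suc k)) \<in> S"
        using a[of k] a[of "Suc k"] that by (auto simp: S_def)
      from bound[OF this] show ?thesis
        using a(3)[of k] unfolding of_real_diff[symmetric]
        by (simp add: norm_divide power2_eq_square algebra_simps)
    qed
    have "Ln (1 - f z) = \<phi> 0 (a N) - \<phi> 0 (a 0)"
      using \<open>N > 0\<close> by (simp add: \<phi>_def a_def)
    also have "\<dots> = (\<Sum>k<N. \<phi> 0 (a (Suc k)) - \<phi> 0 (a k))"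
      by (rule sum_lessThan_telescope[symmetric])
    finally have "Ln (1 - f z) - R z = (\<Sum>k<N. \<phi> 0 (a (Suc k)) - \<phi> 0 (a k) - \<phi> 1 (a k) / of_nat N)"
      by (simp add: R_def sum_subtractf[symmetric] \<phi>_def mult.commute)
    also have "cmod \<dots> \<le> (\<Sum>k<N. C / (real N)\<^sup>2)"
      by (intro sum_norm_le step) simp
    also have "\<dots> = C / real N" using \<open>N > 0\<close> by (simp add: power2_eq_square)
    also have "\<dots> \<le> e" using N \<open>N > 0\<close> \<open>e > 0\<close> by (simp add: field_simps)
    finally show ?thesis by (simp add: norm_minus_commute)
  qed
  ultimately show "\<exists>g. approximable K g \<and> (\<forall>z\<in>K. cmod (g z - Ln (1 - f z)) \<le> e)" by blast
qed

section \<open>Planes over rays\<close>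

text \<open>If \<open>\<tau>\<close> is not real and \<open>(1, \<tau>)\<close> is a left eigenvector of a real matrix \<open>A\<close>, then so is its conjugate, and
  \<open>coord \<tau>\<close>, \<open>coord (cnj \<tau>)\<close> are complex coordinates in which \<open>A\<close> is diagonal.\<close>

definition coord :: "complex \<Rightarrow> complex ^ 2 \<Rightarrow> complex" where
  "coord \<tau> z = z $ 1 + \<tau> * z $ 2"

text \<open>In the coordinates \<open>(u, v) = (coord \<tau> z, coord (cnj \<tau>) z)\<close> this is the graph \<open>v = c \<cdot> cnj u\<close>.
  Under the hypotheses of the theorem every \<open>M (A j)\<close> has this form, and \<open>c = 1\<close> gives the real plane.\<close>

definition plane :: "complex \<Rightarrow> complex \<Rightarrow> (complex ^ 2) set" where
  "plane \<tau> c = {z. coord (cnj \<tau>) z = c * cnj (coord \<tau> z)}"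

text \<open>The product of the two coordinates. On the plane with parameter \<open>c\<close> it equals
  \<open>c \<bar>u\<bar>\<^sup>2\<close>, so it folds that plane onto the ray through \<open>c\<close>, each circle to a point. This
  reduces the problem to a one-variable problem about rays in the complex plane.\<close>

definition quad :: "complex \<Rightarrow> complex ^ 2 \<Rightarrow> complex" where
  "quad \<tau> z = coord \<tau> z * coord (cnj \<tau>) z"

lemma entire_coord [intro]: "entire (coord \<tau>)"
  unfolding coord_def[abs_def] by (intro entire_add entire_mult entire_const entire_nth)

lemma entire_quad [intro]: "entire (quad \<tau>)"
  unfolding quad_def[abs_def] by (intro entire_mult entire_coord)

lemma continuous_on_coord [continuous_intros]:
  "continuous_on K f \<Longrightarrow> continuous_on K (\<lambda>x. coord \<tau> (f x))"
  unfolding coord_def by (intro continuous_intros)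

lemma continuous_on_quad [continuous_intros]:
  "continuous_on K f \<Longrightarrow> continuous_on K (\<lambda>x. quad \<tau> (f x))"
  unfolding quad_def by (intro continuous_intros)

lemma coord_0 [simp]: "coord \<tau> 0 = 0" and quad_0 [simp]: "quad \<tau> 0 = 0"
  by (simp_all add: coord_def quad_def)

lemma components_from_coords:
  assumes "Im \<tau> \<noteq> 0"
  shows "z $ 1 = (\<tau> * coord (cnj \<tau>) z - cnj \<tau> * coord \<tau> z) / (\<tau> - cnj \<tau>)"
    and "z $ 2 = (coord \<tau> z - coord (cnj \<tau>) z) / (\<tau> - cnj \<tau>)"
proof -
  have "\<tau> - cnj \<tau> \<noteq> 0" using assms by (simp add: complex_eq_iff)
  thus "z $ 1 = (\<tau> * coord (cnj \<tau>) z - cnj \<tau> * coord \<tau> z) / (\<tau> - cnj \<tau>)"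
    and "z $ 2 = (coord \<tau> z - coord (cnj \<tau>) z) / (\<tau> - cnj \<tau>)"
    by (simp_all add: coord_def field_simps)
qed

lemma coords_eqI:
  assumes "Im \<tau> \<noteq> 0" "coord \<tau> z = coord \<tau> z'" "coord (cnj \<tau>) z = coord (cnj \<tau>) z'"
  shows "z = z'"
  using components_from_coords[OF assms(1)] assms(2,3) by (simp add: vec_eq_iff forall_2)

lemma norm_le_coords:
  assumes "Im \<tau> \<noteq> 0"
  obtains B where "B > 0" "\<And>z. norm z \<le> B * (cmod (coord \<tau> z) + cmod (coord (cnj \<tau>) z))"
proof -
  define d where "d = cmod (\<tau> - cnj \<tau>)"
  have d: "d > 0" using assms by (simp add: complex_eq_iff d_def)
  have "norm z \<le> ((cmod \<tau> + 1) / d) * (cmod (coord \<tau> z) + cmod (coord (cnj \<tau>) z))" for z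
  proof -
    have "norm z \<le> cmod (z $ 1) + cmod (z $ 2)"
      using L2_set_le_sum[of "UNIV :: 2 set" "\<lambda>i. cmod (z $ i)"]
      by (simp add: norm_vec_def UNIV_2)
    also have "\<dots> \<le> (cmod \<tau> * cmod (coord (cnj \<tau>) z) + cmod \<tau> * cmod (coord \<tau> z)) / d +
        (cmod (coord \<tau> z) + cmod (coord (cnj \<tau>) z)) / d"
    proof (intro add_mono)
      show "cmod (z $ 1) \<le> (cmod \<tau> * cmod (coord (cnj \<tau>) z) + cmod \<tau> * cmod (coord \<tau> z)) / d"
        unfolding components_from_coords(1)[OF assms, of z] norm_divide d_def[symmetric]
        using d by (intro divide_right_mono order_trans[OF norm_triangle_ineq4]) (auto simp: norm_mult)
      show "cmod (z $ 2) \<le> (cmod (coord \<tau> z) + cmod (coord (cnj \<tau>) z)) / d"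
        unfolding components_from_coords(2)[OF assms, of z] norm_divide d_def[symmetric]
        using d by (intro divide_right_mono norm_triangle_ineq4) auto
    qed
    also have "\<dots> = ((cmod \<tau> + 1) / d) * (cmod (coord \<tau> z) + cmod (coord (cnj \<tau>) z))"
      using d by (simp add: field_simps)
    finally show ?thesis .
  qed
  moreover have "(cmod \<tau> + 1) / d > 0" using d by (simp add: add_nonneg_pos)
  ultimately show ?thesis using that by blast
qed

lemma closed_plane: "closed (plane \<tau> c)"
  unfolding plane_def by (intro closed_Collect_eq continuous_intros)

lemma quad_on_plane: "z \<in> plane \<tau> c \<Longrightarrow> quad \<tau> z = c * of_real ((cmod (coord \<tau> z))\<^sup>2)"
  by (simp add: plane_def quad_def complex_norm_square mult_ac flip: of_real_power)

lemma coord_plane_eq_0_iff: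
  assumes "Im \<tau> \<noteq> 0" "z \<in> plane \<tau> c"
  shows "coord \<tau> z = 0 \<longleftrightarrow> z = 0"
  using assms coords_eqI[OF assms(1), of z 0] by (auto simp: plane_def)

lemma sgn_quad_on_plane:
  assumes "Im \<tau> \<noteq> 0" "z \<in> plane \<tau> c" "z \<noteq> 0"
  shows "sgn (quad \<tau> z) = sgn c"
  using assms coord_plane_eq_0_iff[OF assms(1,2)]
  by (simp add: quad_on_plane sgn_mult sgn_of_real flip: of_real_power)

text \<open>A point of the ray that is close to \<open>\<alpha>\<close> has modulus close to \<open>1\<close>, hence is close to \<open>u\<close>: the
  unit point of the ray represents the whole ray up to a factor \<open>2\<close>.\<close>

lemma far_from_ray:
  fixes \<alpha> u :: complex
  assumes "cmod \<alpha> = 1" "cmod u = 1" "r \<ge> 0"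
  shows "cmod (\<alpha> - u) \<le> 2 * cmod (\<alpha> - of_real r * u)"
proof -
  have "\<bar>1 - r\<bar> \<le> cmod (\<alpha> - of_real r * u)"
    using norm_triangle_ineq3[of \<alpha> "of_real r * u"] assms by (simp add: norm_mult)
  moreover have "of_real r * u - u = of_real (r - 1) * u" by (simp add: algebra_simps)
  hence "cmod (of_real r * u - u) = \<bar>1 - r\<bar>"
    using assms(2) by (simp only: norm_mult norm_of_real) simp
  ultimately show ?thesis using norm_triangle_ineq[of "\<alpha> - of_real r * u" "of_real r * u - u"] by simp
qed

text \<open>A finite family of planes lying over distinct rays. Injectivity of \<open>sgn\<close> says that no two
  parameters are positive multiples of each other.\<close>

locale pencil =
  fixes \<tau> :: complex and C :: "complex set"
  assumes Im_tau: "Im \<tau> \<noteq> 0" and finite_C: "finite C" and C_nonzero: "0 \<notin> C"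
    and rays_distinct: "inj_on sgn C"
begin

abbreviation "p \<equiv> quad \<tau>"

definition S :: "(complex ^ 2) set" where "S = (\<Union>c\<in>C. plane \<tau> c)"

text \<open>The exhaustion of \<open>S\<close> is by the size of \<open>p\<close> and not by the norm, because the cut-off
  functions constructed below are functions of \<open>p\<close>.\<close>

definition S_upto :: "real \<Rightarrow> (complex ^ 2) set" where "S_upto T = {z\<in>S. cmod (p z) \<le> T}"

lemma closed_S: "closed S"
  unfolding S_def using finite_C closed_plane by (intro closed_UN) auto

lemma norm_sgn_C: "c \<in> C \<Longrightarrow> cmod (sgn c) = 1"
  using C_nonzero by (auto simp: norm_sgn)

lemma sgn_p: "c \<in> C \<Longrightarrow> z \<in> plane \<tau> c \<Longrightarrow> z \<noteq> 0 \<Longrightarrow> sgn (p z) = sgn c"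
  using sgn_quad_on_plane[OF Im_tau] by blast

lemma p_eq_0_iff: "z \<in> S \<Longrightarrow> p z = 0 \<longleftrightarrow> z = 0"
  using sgn_p norm_sgn_C unfolding S_def by fastforce

lemma p_polar: "c \<in> C \<Longrightarrow> z \<in> plane \<tau> c \<Longrightarrow> p z = of_real (cmod (p z)) * sgn c"
proof (cases "z = 0")
  case False
  assume c: "c \<in> C" "z \<in> plane \<tau> c"
  have "p z = of_real (cmod (p z)) * sgn (p z)" by (cases "p z = 0") (simp_all add: sgn_eq)
  thus ?thesis using sgn_p[OF c False] by simp
qed simp

lemma p_polar_S:
  assumes "z \<in> S"
  obtains c where "c \<in> C" "p z = of_real (cmod (p z)) * sgn c"
  using assms p_polar unfolding S_def by blast

lemma plane_unique:
  assumes "c \<in> C" "c' \<in> C" "z \<in> plane \<tau> c" "z \<in> plane \<tau> c'" "z \<noteq> 0"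
  shows "c = c'"
  using assms sgn_p rays_distinct by (metis inj_onD)

lemma compact_S_upto: "compact (S_upto T)"
proof -
  obtain B where B: "B > 0" "\<And>z. norm z \<le> B * (cmod (coord \<tau> z) + cmod (coord (cnj \<tau>) z))"
    using norm_le_coords[OF Im_tau] by blast
  have "bounded (\<Union>c\<in>C. {z\<in>plane \<tau> c. cmod (p z) \<le> T})"
  proof (intro bounded_UN finite_C ballI)
    fix c assume c: "c \<in> C"
    have c0: "cmod c > 0" using c C_nonzero by auto
    have "norm z \<le> B * (sqrt (T / cmod c) + cmod c * sqrt (T / cmod c))"
      if z: "z \<in> plane \<tau> c" "cmod (p z) \<le> T" for z
    proof -
      have "cmod c * (cmod (coord \<tau> z))\<^sup>2 \<le> T"
        using z by (simp add: quad_on_plane norm_mult norm_power)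
      hence le: "cmod (coord \<tau> z) \<le> sqrt (T / cmod c)"
        using c0 by (intro real_le_rsqrt) (simp add: field_simps)
      have "cmod (coord (cnj \<tau>) z) = cmod c * cmod (coord \<tau> z)"
        using z by (simp add: plane_def norm_mult)
      also have "\<dots> \<le> cmod c * sqrt (T / cmod c)" using le by (intro mult_left_mono) auto
      finally have "B * (cmod (coord \<tau> z) + cmod (coord (cnj \<tau>) z)) \<le>
          B * (sqrt (T / cmod c) + cmod c * sqrt (T / cmod c))"
        using le B by (intro mult_left_mono add_mono) auto
      thus ?thesis using B(2)[of z] by linarith
    qed
    thus "bounded {z\<in>plane \<tau> c. cmod (p z) \<le> T}" by (intro boundedI) auto
  qed
  moreover have "S_upto T = (\<Union>c\<in>C. {z\<in>plane \<tau> c. cmod (p z) \<le> T})"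
    by (auto simp: S_upto_def S_def)
  moreover have "closed (S \<inter> {z. cmod (p z) \<le> T})"
    by (intro closed_Int closed_S closed_Collect_le continuous_intros)
  ultimately show ?thesis
    by (simp add: compact_eq_bounded_closed S_upto_def Collect_conj_eq)
qed

section \<open>Separating the rays\<close>

text \<open>For \<open>w\<close> on the ray of \<open>u\<close>, this is the limit of
  \<open>Ln (1 - n w / \<alpha>) - Ln (1 - n w / \<beta>)\<close> as \<open>n\<close> tends to infinity: the moduli cancel, and what
  remains depends on the ray only. It changes by \<open>2 \<pi> \<i>\<close> when the ray crosses \<open>\<alpha>\<close> or \<open>\<beta>\<close>.\<close>

definition jump :: "complex \<Rightarrow> complex \<Rightarrow> complex \<Rightarrow> complex" where
  "jump \<alpha> \<beta> u = Ln (- u / \<alpha>) - Ln (- u / \<beta>)"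

text \<open>Put \<open>\<alpha>\<close> and \<open>\<beta>\<close> on either side of the ray of \<open>c0\<close>, at a small angle \<open>e\<close>. As \<open>e\<close> shrinks, the
  jump at this ray tends to \<open>2 \<pi> \<i>\<close> and the jump at every other ray tends to \<open>0\<close>.\<close>

lemma exists_separating_jump:
  assumes c: "c0 \<in> C" "c1 \<in> C" "c0 \<noteq> c1"
  shows "\<exists>\<alpha> \<beta>. cmod \<alpha> = 1 \<and> cmod \<beta> = 1 \<and> \<alpha> \<notin> sgn ` C \<and> \<beta> \<notin> sgn ` C \<and>
      jump \<alpha> \<beta> (sgn c0) \<noteq> jump \<alpha> \<beta> (sgn c1)"
proof -
  define u0 where "u0 = sgn c0"
  define v where "v = sgn c1 / u0"
  have u0: "cmod u0 = 1" "u0 \<noteq> 0" using norm_sgn_C[OF c(1)] by (auto simp: u0_def)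
  have "sgn c0 \<noteq> sgn c1" using rays_distinct c by (auto dest: inj_onD)
  hence v: "cmod v = 1" "v \<noteq> 1"
    using norm_sgn_C[OF c(2)] u0 by (auto simp: v_def norm_divide u0_def)
  have vn: "- v \<notin> \<real>\<^sub>\<le>\<^sub>0"
  proof
    assume "- v \<in> \<real>\<^sub>\<le>\<^sub>0"
    hence "v \<in> \<real>\<^sub>\<ge>\<^sub>0" by simp
    then obtain x where "v = of_real x" "x \<ge> 0" by (auto elim: nonneg_Reals_cases)
    thus False using v by simp
  qed
  have avoid: "\<forall>\<^sub>F e in at_right 0. u0 * cis (s * e) \<notin> sgn ` C" if s: "s = 1 \<or> s = -1" for s :: real
  proof -
    have "\<forall>\<^sub>F e in at_right 0. \<forall>w\<in>sgn ` C. u0 * cis (s * e) \<noteq> w"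
    proof (intro eventually_ball_finite finite_imageI finite_C ballI)
      fix w assume "w \<in> sgn ` C"
      show "\<forall>\<^sub>F e in at_right 0. u0 * cis (s * e) \<noteq> w"
      proof (cases "w = u0")
        case True
        have "\<forall>\<^sub>F e in at_right (0::real). 0 < e \<and> e < pi"
          by (intro eventually_conj eventually_at_right_less)
             (auto simp: eventually_at_right_field intro: exI[of _ pi])
        thus ?thesis
        proof eventually_elim
          case (elim e)
          hence "sin e > 0" by (intro sin_gt_zero) auto
          hence "Im (cis (s * e)) \<noteq> 0" using s by auto
          hence "cis (s * e) \<noteq> 1" by (auto simp del: cis.simps)
          thus ?case using True u0 by simp
        qed
      next
        case False
        have "((\<lambda>e. u0 * cis (s * e)) \<longlongrightarrow> u0 * cis (s * 0)) (at_right 0)"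
          by (intro tendsto_intros)
        thus ?thesis using False by (intro tendsto_imp_eventually_ne) auto
      qed
    qed
    thus ?thesis by eventually_elim auto
  qed
  have "((\<lambda>e. (\<i> * of_real (2 * (pi - e))) - (Ln (- v * cis (- e)) - Ln (- v * cis e))) \<longlongrightarrow>
      (\<i> * of_real (2 * (pi - 0))) - (Ln (- v * cis (- 0)) - Ln (- v * cis 0))) (at_right 0)"
    using vn by (intro tendsto_intros) auto
  hence neq: "\<forall>\<^sub>F e in at_right 0.
      (\<i> * of_real (2 * (pi - e))) - (Ln (- v * cis (- e)) - Ln (- v * cis e)) \<noteq> 0"
    by (rule tendsto_imp_eventually_ne) auto
  have "\<forall>\<^sub>F e in at_right (0::real). 0 < e \<and> e < pi"
    by (intro eventually_conj eventually_at_right_less)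
       (auto simp: eventually_at_right_field intro: exI[of _ pi])
  with neq avoid[of 1] avoid[of "-1"] have "\<forall>\<^sub>F e in at_right 0. 0 < e \<and> e < pi \<and>
      u0 * cis e \<notin> sgn ` C \<and> u0 * cis (- e) \<notin> sgn ` C \<and>
      (\<i> * of_real (2 * (pi - e))) \<noteq> Ln (- v * cis (- e)) - Ln (- v * cis e)"
    unfolding mult_1 mult_minus1 simp_thms right_minus_eq eventually_conj_iff by fast
  from eventually_happens'[OF trivial_limit_at_right_real this] obtain e where e: "0 < e" "e < pi" "u0 * cis e \<notin> sgn ` C" "u0 * cis (- e) \<notin> sgn ` C"
      "(\<i> * of_real (2 * (pi - e))) \<noteq> Ln (- v * cis (- e)) - Ln (- v * cis e)"
    by blast
  (* At the ray of c0, the two logarithms in the jump have arguments pi - e and e - pi. *)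
  have Ln_cis: "Ln (cis t) = \<i> * of_real t" if "- pi < t" "t \<le> pi" for t
    using that by (simp add: cis_conv_exp Ln_exp mult.commute)
  have "- u0 / (u0 * cis e) = cis (pi - e)"
    using u0 cis_divide[of pi e] by simp
  moreover have "- u0 / (u0 * cis (- e)) = cis (e - pi)"
    using u0 cis_divide[of e pi] by (simp add: inverse_eq_divide[symmetric] flip: cis_inverse)
  ultimately have "jump (u0 * cis e) (u0 * cis (- e)) (sgn c0) = Ln (cis (pi - e)) - Ln (cis (e - pi))"
    by (simp add: jump_def u0_def)
  also have "\<dots> = \<i> * of_real (2 * (pi - e))"
    using e by (simp add: Ln_cis algebra_simps)
  finally have "jump (u0 * cis e) (u0 * cis (- e)) (sgn c0) = \<i> * of_real (2 * (pi - e))" .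
  moreover have "jump (u0 * cis e) (u0 * cis (- e)) (sgn c1) = Ln (- v * cis (- e)) - Ln (- v * cis e)"
  proof -
    have "- sgn c1 / (u0 * cis e) = - v * cis (- e)" "- sgn c1 / (u0 * cis (- e)) = - v * cis e"
      using u0 by (simp_all add: v_def flip: cis_inverse add: divide_inverse)
    thus ?thesis by (simp only: jump_def)
  qed
  ultimately show ?thesis
    using e u0 by (intro exI[of _ "u0 * cis e"] exI[of _ "u0 * cis (- e)"]) (simp add: norm_mult)
qed
end

lemma Ln_diff_bound:
  assumes "a \<noteq> 0" "b \<noteq> 0" "cmod a \<le> D * cmod b" "cmod b \<le> D * cmod a"
  shows "cmod (Ln a - Ln b) \<le> ln D + 2 * pi"
proof -
  have D: "D > 0" using assms by (smt (verit) norm_eq_zero norm_ge_zero zero_less_mult_iff)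
  have "ln (cmod a) \<le> ln (D * cmod b)" "ln (cmod b) \<le> ln (D * cmod a)"
    using assms D by (auto intro!: ln_mono)
  hence "ln (cmod a) \<le> ln D + ln (cmod b)" "ln (cmod b) \<le> ln D + ln (cmod a)"
    using D assms by (auto simp: ln_mult)
  hence "\<bar>Re (Ln a - Ln b)\<bar> \<le> ln D" using assms by (simp add: abs_le_iff)
  moreover have "\<bar>Im (Ln a - Ln b)\<bar> \<le> 2 * pi"
    using Im_Ln_le_pi[of a] Im_Ln_le_pi[of b] mpi_less_Im_Ln[of a] mpi_less_Im_Ln[of b] assms
    by (simp add: abs_le_iff)
  ultimately show ?thesis using cmod_le[of "Ln a - Ln b"] by linarith
qed

context pencil
begin

lemma far_from_rays:
  assumes "cmod \<alpha> = 1" "\<alpha> \<notin> sgn ` C"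
  obtains d where "d > 0" "\<And>z r. z \<in> S \<Longrightarrow> r \<ge> 0 \<Longrightarrow> d \<le> cmod (\<alpha> - of_real r * p z)"
proof -
  obtain d where d: "d > 0" "\<And>u. u \<in> sgn ` C \<Longrightarrow> d \<le> dist \<alpha> u"
    using finite_set_avoid[of "sgn ` C" \<alpha>] finite_C assms(2) by (metis finite_imageI)
  have "d / 2 \<le> cmod (\<alpha> - of_real r * p z)" if z: "z \<in> S" "r \<ge> 0" for z r
  proof -
    obtain c where c: "c \<in> C" "p z = of_real (cmod (p z)) * sgn c" using p_polar_S[OF z(1)] .
    have "d \<le> 2 * cmod (\<alpha> - of_real (r * cmod (p z)) * sgn c)"
      using far_from_ray[OF assms(1) norm_sgn_C[OF c(1)], of "r * cmod (p z)"] d(2)[of "sgn c"] c(1) z(2)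
      by (simp add: dist_norm)
    thus ?thesis by (subst c(2)) (simp add: mult.assoc)
  qed
  thus ?thesis using that[of "d / 2"] d by simp
qed

text \<open>The functions \<open>Ln (1 - n p / \<alpha>) - Ln (1 - n p / \<beta>)\<close> are approximable because no ray meets \<open>\<alpha>\<close>
  or \<open>\<beta>\<close>. They are bounded on \<open>S\<close> uniformly in \<open>n\<close> and converge to the jump, uniformly away from the
  origin. The convergence fails at the origin, where the rays meet; multiplying by a function that
  vanishes there makes it uniform.\<close>

lemma approximable_mult_jump:
  assumes \<alpha>: "cmod \<alpha> = 1" "\<alpha> \<notin> sgn ` C" and \<beta>: "cmod \<beta> = 1" "\<beta> \<notin> sgn ` C"
    and g: "approximable (S_upto T) g" "g 0 = 0"
  shows "approximable (S_upto T) (\<lambda>z. g z * jump \<alpha> \<beta> (sgn (p z)))"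
proof (rule approximable_limit)
  fix e :: real assume "e > 0"
  let ?K = "S_upto T"
  have K: "compact ?K" by (rule compact_S_upto)
  have KS: "z \<in> S" if "z \<in> ?K" for z using that by (simp add: S_upto_def)
  have nz: "\<alpha> \<noteq> 0" "\<beta> \<noteq> 0" using \<alpha> \<beta> by auto
  obtain d1 where d1: "d1 > 0" "\<And>z r. z \<in> S \<Longrightarrow> r \<ge> 0 \<Longrightarrow> d1 \<le> cmod (\<alpha> - of_real r * p z)"
    using far_from_rays[OF \<alpha>] by blast
  obtain d2 where d2: "d2 > 0" "\<And>z r. z \<in> S \<Longrightarrow> r \<ge> 0 \<Longrightarrow> d2 \<le> cmod (\<beta> - of_real r * p z)"
    using far_from_rays[OF \<beta>] by blast
  define d where "d = min d1 d2"
  have d: "d > 0" "\<And>z r. z \<in> S \<Longrightarrow> r \<ge> 0 \<Longrightarrow> d \<le> cmod (\<alpha> - of_real r * p z)"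
    "\<And>z r. z \<in> S \<Longrightarrow> r \<ge> 0 \<Longrightarrow> d \<le> cmod (\<beta> - of_real r * p z)"
    using d1 d2 by (auto simp: d_def min_le_iff_disj)
  have shift: "cmod (1 - of_real s * (of_nat n / \<gamma> * p z)) = cmod (\<gamma> - of_real (s * real n) * p z)"
    if "cmod \<gamma> = 1" for s n \<gamma> z
  proof -
    have "\<gamma> \<noteq> 0" using that by auto
    hence "1 - of_real s * (of_nat n / \<gamma> * p z) = (\<gamma> - of_real (s * real n) * p z) / \<gamma>"
      by (simp add: field_simps)
    thus ?thesis using that by (simp add: norm_divide)
  qed
  define L where "L = (\<lambda>n z. Ln (1 - of_nat n / \<alpha> * p z) - Ln (1 - of_nat n / \<beta> * p z))"
  have L_approx: "approximable ?K (L n)" for n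
  proof -
    have f: "approximable ?K (\<lambda>z. of_nat n / \<gamma> * p z)" for \<gamma>
      by (intro approximable_cmult approximable_entire entire_quad)
    have "d \<le> cmod (1 - of_real s * (of_nat n / \<alpha> * p z))"
      "d \<le> cmod (1 - of_real s * (of_nat n / \<beta> * p z))"
      if "z \<in> ?K" "0 \<le> s" "s \<le> 1" for z s
      unfolding shift[OF \<alpha>(1)] shift[OF \<beta>(1)] using that d(2,3)[OF KS, of z "s * real n"] by simp_all
    thus ?thesis
      unfolding L_def by (intro approximable_diff approximable_Ln[OF K f d(1)])
  qed
  define D where "D = 1 + 2 / d"
  define M where "M = ln D + 2 * pi"
  have "ln D \<ge> 0" using d(1) by (simp add: D_def)
  hence M: "M > 0" "M \<ge> 2 * pi" using pi_gt_zero unfolding M_def by linarith+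
  have L_bound: "cmod (L n z) \<le> M" if z: "z \<in> S" for n z
  proof -
    let ?a = "1 - of_nat n / \<alpha> * p z" and ?b = "1 - of_nat n / \<beta> * p z"
    have a: "cmod ?a = cmod (\<alpha> - of_real (real n) * p z)" using shift[OF \<alpha>(1), of 1 n z] by simp
    have b: "cmod ?b = cmod (\<beta> - of_real (real n) * p z)" using shift[OF \<beta>(1), of 1 n z] by simp
    have ab: "d \<le> cmod ?a" "d \<le> cmod ?b" unfolding a b using d(2,3)[OF z, of "real n"] by simp_all
    have "cmod (\<alpha> - \<beta>) \<le> 2" "cmod (\<beta> - \<alpha>) \<le> 2"
      using norm_triangle_ineq4[of \<alpha> \<beta>] \<alpha> \<beta> by (auto simp: norm_minus_commute)
    hence "cmod ?a \<le> 2 + cmod ?b" "cmod ?b \<le> 2 + cmod ?a"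
      unfolding a b
      using norm_triangle_ineq[of "\<alpha> - \<beta>" "\<beta> - of_real (real n) * p z"]
        norm_triangle_ineq[of "\<beta> - \<alpha>" "\<alpha> - of_real (real n) * p z"] by auto
    moreover have "2 + t \<le> D * t" if "d \<le> t" for t
      using that d(1) by (simp add: D_def field_simps)
    ultimately have "cmod ?a \<le> D * cmod ?b" "cmod ?b \<le> D * cmod ?a"
      using ab by (meson order_trans)+
    thus ?thesis
      using ab d(1) unfolding L_def M_def by (intro Ln_diff_bound) auto
  qed
  have jump_bound: "cmod (jump \<alpha> \<beta> u) \<le> M" if "u \<in> sgn ` C" for u
  proof -
    have "cmod u = 1" using that norm_sgn_C by auto
    hence "cmod (jump \<alpha> \<beta> u) \<le> ln 1 + 2 * pi"
      unfolding jump_def using \<alpha> \<beta> nz by (intro Ln_diff_bound) (auto simp: norm_divide)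
    thus ?thesis using M by simp
  qed
  obtain B where B: "B > 0" "\<And>z. z \<in> ?K \<Longrightarrow> cmod (g z) \<le> B"
    using approximable_bounded[OF K g(1)] by blast
  have "e / B > 0" using B \<open>e > 0\<close> by simp
  have "\<forall>\<^sub>F x in at_right 0. \<forall>u\<in>sgn ` C.
      dist (Ln (of_real x - u / \<alpha>) - Ln (of_real x - u / \<beta>)) (jump \<alpha> \<beta> u) < e / B"
  proof (intro eventually_ball_finite finite_imageI finite_C ballI)
    fix u assume u: "u \<in> sgn ` C"
    have np: "- u / \<gamma> \<notin> \<real>\<^sub>\<le>\<^sub>0" if "cmod \<gamma> = 1" "\<gamma> \<notin> sgn ` C" for \<gamma>
    proof
      assume "- u / \<gamma> \<in> \<real>\<^sub>\<le>\<^sub>0"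
      hence "u / \<gamma> \<in> \<real>\<^sub>\<ge>\<^sub>0" by simp
      then obtain x where x: "u / \<gamma> = of_real x" "x \<ge> 0" by (auto elim: nonneg_Reals_cases)
      have "cmod (u / \<gamma>) = 1" using u norm_sgn_C that by (auto simp: norm_divide)
      hence "u / \<gamma> = 1" using x by simp
      thus False using u that by (auto simp: divide_eq_1_iff)
    qed
    have "((\<lambda>x. Ln (of_real x - u / \<alpha>) - Ln (of_real x - u / \<beta>)) \<longlongrightarrow>
        Ln (of_real 0 - u / \<alpha>) - Ln (of_real 0 - u / \<beta>)) (at_right 0)"
      using np[OF \<alpha>] np[OF \<beta>] by (intro tendsto_intros) auto
    hence "((\<lambda>x. Ln (of_real x - u / \<alpha>) - Ln (of_real x - u / \<beta>)) \<longlongrightarrow> jump \<alpha> \<beta> u) (at_right 0)"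
      by (simp add: jump_def)
    thus "\<forall>\<^sub>F x in at_right 0.
        dist (Ln (of_real x - u / \<alpha>) - Ln (of_real x - u / \<beta>)) (jump \<alpha> \<beta> u) < e / B"
      using \<open>e / B > 0\<close> by (rule tendstoD)
  qed
  then obtain x0 where x0: "x0 > 0" "\<And>x u. 0 < x \<Longrightarrow> x < x0 \<Longrightarrow> u \<in> sgn ` C \<Longrightarrow>
      cmod (Ln (of_real x - u / \<alpha>) - Ln (of_real x - u / \<beta>) - jump \<alpha> \<beta> u) < e / B"
    unfolding eventually_at_right_field dist_norm by blast
  (* Off K' the factor g is so small that boundedness suffices; on K' the value p z stays away
     from 0 and the convergence is uniform. *)
  define K' where "K' = ?K \<inter> (\<lambda>z. cmod (g z)) -` {e / (2 * M)..}"
  have "e / (2 * M) > 0" using \<open>e > 0\<close> M by simp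
  hence K'0: "z \<in> S" "z \<noteq> 0" if "z \<in> K'" for z using that g(2) KS by (auto simp: K'_def)
  have "closed K'" unfolding K'_def
    using K approximable_imp_continuous_on[OF g(1)]
    by (intro continuous_closed_preimage continuous_intros compact_imp_closed) auto
  hence "compact K'" using K compact_Int_closed[of ?K K'] by (simp add: K'_def Int_absorb1 Int_ac)
  have "\<exists>\<delta>>0. \<forall>z\<in>K'. \<delta> \<le> cmod (p z)"
  proof (cases "K' = {}")
    case False
    have "continuous_on K' (\<lambda>z. cmod (p z))" by (intro continuous_intros)
    then obtain y where "y \<in> K'" "\<And>z. z \<in> K' \<Longrightarrow> cmod (p y) \<le> cmod (p z)"
      using continuous_attains_inf[OF \<open>compact K'\<close> False] by blast
    thus ?thesis using K'0 p_eq_0_iff by (intro exI[of _ "cmod (p y)"]) auto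
  qed (auto intro: exI[of _ 1])
  then obtain \<delta> where \<delta>: "\<delta> > 0" "\<And>z. z \<in> K' \<Longrightarrow> \<delta> \<le> cmod (p z)" by blast
  obtain n :: nat where n: "real n > 1 / (\<delta> * x0)" using reals_Archimedean2 by blast
  have "1 / (\<delta> * x0) > 0" using \<delta> x0 by simp
  hence n0: "n > 0" using n by (cases n) auto
  have "cmod (g z * L n z - g z * jump \<alpha> \<beta> (sgn (p z))) \<le> e" if z: "z \<in> ?K" for z
  proof (cases "z = 0")
    case False
    have pz: "p z \<noteq> 0" using p_eq_0_iff KS[OF z] False by simp
    define u where "u = sgn (p z)"
    have u: "u \<in> sgn ` C" using KS[OF z] sgn_p False by (auto simp: S_def u_def)
    show ?thesis
    proof (cases "z \<in> K'")
      case True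
      define q where "q = cmod (p z)"
      (* Scaling by n q turns the limit for large n into the limit x -> 0. *)
      define x where "x = 1 / (real n * q)"
      have q: "q > 0" "\<delta> \<le> q" using pz \<delta>(2)[OF True] by (auto simp: q_def)
      have "1 / (real n * q) \<le> 1 / (real n * \<delta>)"
        using q \<delta> n0 by (intro divide_left_mono mult_left_mono mult_pos_pos) auto
      also have "\<dots> < x0" using n \<delta> x0 n0 by (simp add: field_simps)
      finally have x: "0 < x" "x < x0" using q n0 by (auto simp: x_def)
      have pq: "p z = of_real q * u" using pz by (simp add: q_def u_def sgn_eq)
      have scale: "Ln (1 - of_nat n / \<gamma> * p z) = of_real (ln (real n * q)) + Ln (of_real x - u / \<gamma>)"
        if "\<gamma> \<noteq> 0" "1 - of_nat n / \<gamma> * p z \<noteq> 0" for \<gamma>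
      proof -
        have "1 - of_nat n / \<gamma> * p z = of_real (real n * q) * (of_real x - u / \<gamma>)"
          using n0 q that by (simp add: x_def pq field_simps)
        moreover from this that have "of_real x - u / \<gamma> \<noteq> 0" by auto
        moreover have "real n * q > 0" using n0 q by simp
        ultimately show ?thesis by (simp only: Ln_times_of_real Ln_of_real simp_thms)
      qed
      have "cmod (1 - of_nat n / \<gamma> * p z) = cmod (\<gamma> - of_real (real n) * p z)"
        if "cmod \<gamma> = 1" for \<gamma>
        using shift[OF that, of 1 n z] by simp
      hence nzn: "1 - of_nat n / \<alpha> * p z \<noteq> 0" "1 - of_nat n / \<beta> * p z \<noteq> 0"
        using d(2,3)[OF KS[OF z], of "real n"] d(1) \<alpha> \<beta> by (smt (verit) norm_zero of_nat_0_le_iff)+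
      have "L n z = Ln (of_real x - u / \<alpha>) - Ln (of_real x - u / \<beta>)"
        unfolding L_def scale[OF nz(1) nzn(1)] scale[OF nz(2) nzn(2)] by simp
      hence "cmod (L n z - jump \<alpha> \<beta> u) < e / B" using x0(2)[OF x u] by simp
      hence "cmod (g z) * cmod (L n z - jump \<alpha> \<beta> u) \<le> B * (e / B)"
        using B z by (intro mult_mono) auto
      thus ?thesis using B by (simp add: u_def norm_mult flip: right_diff_distrib)
    next
      case False
      hence "cmod (g z) \<le> e / (2 * M)" using z by (simp add: K'_def)
      moreover have "cmod (L n z - jump \<alpha> \<beta> u) \<le> 2 * M"
        using norm_triangle_ineq4[of "L n z" "jump \<alpha> \<beta> u"] L_bound[OF KS[OF z], of n]
          jump_bound[OF u] by linarith
      ultimately have "cmod (g z) * cmod (L n z - jump \<alpha> \<beta> u) \<le> (e / (2 * M)) * (2 * M)"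
        using \<open>e > 0\<close> M by (intro mult_mono) auto
      thus ?thesis using M by (simp add: u_def norm_mult flip: right_diff_distrib)
    qed
  qed (use g \<open>e > 0\<close> in simp)
  moreover have "approximable ?K (\<lambda>z. g z * L n z)"
    by (intro approximable_mult K g L_approx)
  ultimately show "\<exists>h. approximable ?K h \<and>
      (\<forall>z\<in>?K. cmod (h z - g z * jump \<alpha> \<beta> (sgn (p z))) \<le> e)" by blast
qed

text \<open>Lagrange interpolation in the jumps: for each other plane, one affine factor in a separating jump
  takes the value \<open>1\<close> on the chosen plane and \<open>0\<close> on the other.\<close>

lemma approximable_restrict_plane:
  assumes c: "c \<in> C" and g: "approximable (S_upto T) g" "g 0 = 0"
  shows "approximable (S_upto T) (\<lambda>z. if z \<in> plane \<tau> c then g z else 0)"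
proof -
  have "\<exists>W. approximable (S_upto T) (\<lambda>z. g z * W (sgn (p z))) \<and> W (sgn c) = 1 \<and>
      (\<forall>c'\<in>D. W (sgn c') = 0)" if "finite D" "D \<subseteq> C - {c}" for D
    using that
  proof (induction D rule: finite_induct)
    case empty
    show ?case using g by (intro exI[of _ "\<lambda>_. 1"]) simp
  next
    case (insert c' D)
    then obtain W where W: "approximable (S_upto T) (\<lambda>z. g z * W (sgn (p z)))"
      "W (sgn c) = 1" "\<And>c'. c' \<in> D \<Longrightarrow> W (sgn c') = 0" by auto
    obtain \<alpha> \<beta> where ab: "cmod \<alpha> = 1" "\<alpha> \<notin> sgn ` C" "cmod \<beta> = 1" "\<beta> \<notin> sgn ` C"
      and ne: "jump \<alpha> \<beta> (sgn c) \<noteq> jump \<alpha> \<beta> (sgn c')"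
      using exists_separating_jump[OF c, of c'] insert.prems by auto
    define W' where "W' = (\<lambda>u. W u * ((jump \<alpha> \<beta> u - jump \<alpha> \<beta> (sgn c')) /
        (jump \<alpha> \<beta> (sgn c) - jump \<alpha> \<beta> (sgn c'))))"
    have "approximable (S_upto T) (\<lambda>z. g z * W (sgn (p z)) * jump \<alpha> \<beta> (sgn (p z)))"
      using g by (intro approximable_mult_jump ab W) simp
    from approximable_cmult[OF approximable_diff[OF this approximable_cmult[OF W(1)]],
        of "1 / (jump \<alpha> \<beta> (sgn c) - jump \<alpha> \<beta> (sgn c'))" "jump \<alpha> \<beta> (sgn c')"]
    have "approximable (S_upto T) (\<lambda>z. g z * W' (sgn (p z)))"
      by (rule approximable_cong) (simp add: W'_def divide_inverse algebra_simps)
    moreover have "W' (sgn c) = 1" using ne W by (simp add: W'_def)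
    moreover have "\<forall>d\<in>insert c' D. W' (sgn d) = 0" using W by (auto simp: W'_def)
    ultimately show ?case by blast
  qed
  from this[of "C - {c}"] obtain W where W: "approximable (S_upto T) (\<lambda>z. g z * W (sgn (p z)))"
    "W (sgn c) = 1" "\<And>c'. c' \<in> C \<Longrightarrow> c' \<noteq> c \<Longrightarrow> W (sgn c') = 0" using finite_C by auto
  show ?thesis
  proof (rule approximable_cong[OF W(1)])
    fix z assume "z \<in> S_upto T"
    then obtain c' where c': "c' \<in> C" "z \<in> plane \<tau> c'" by (auto simp: S_upto_def S_def)
    show "g z * W (sgn (p z)) = (if z \<in> plane \<tau> c then g z else 0)"
    proof (cases "z = 0 \<or> c' = c")
      case True
      thus ?thesis using g(2) W(2) c' sgn_p by (cases "z = 0") auto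
    next
      case False
      hence "z \<notin> plane \<tau> c" using plane_unique[of c' c z] c c' by auto
      thus ?thesis using False W(3) sgn_p[OF c'] c' by simp
    qed
  qed
qed

text \<open>Away from the origin exactly one summand is present.\<close>

lemma sum_over_planes:
  assumes "z \<in> S" and "\<And>c. c \<in> C \<Longrightarrow> z \<in> plane \<tau> c \<Longrightarrow> h c = v" and "z = 0 \<Longrightarrow> v = (0::complex)"
  shows "(\<Sum>c\<in>C. if z \<in> plane \<tau> c then h c else 0) = v"
proof (cases "z = 0")
  case True
  hence "v = 0" using assms(3) by simp
  thus ?thesis using assms(2) by (auto intro!: sum.neutral)
next
  case False
  obtain c where c: "c \<in> C" "z \<in> plane \<tau> c" using assms(1) by (auto simp: S_def)
  have "(\<Sum>c\<in>C. if z \<in> plane \<tau> c then h c else 0) = (\<Sum>c'\<in>C. if c' = c then v else 0)"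
    using plane_unique[of c] c False assms(2) by (intro sum.cong) auto
  thus ?thesis using c finite_C by simp
qed

section \<open>Density on compact pieces\<close>

text \<open>On each single plane the conjugate of either coordinate is a multiple of the other coordinate.
  Restriction to planes glues these expressions together, so the algebra of approximable functions
  on \<open>S_upto T\<close> is closed under conjugation of the coordinates, and the Stone-Weierstrass theorem
  applies.\<close>

lemma approximable_cnj_coord:
  "approximable (S_upto T) (\<lambda>z. cnj (coord \<tau> z))"
  "approximable (S_upto T) (\<lambda>z. cnj (coord (cnj \<tau>) z))"
proof -
  have "approximable (S_upto T) (\<lambda>z. \<Sum>c\<in>C. if z \<in> plane \<tau> c then 1 / c * coord (cnj \<tau>) z else 0)"
    by (intro approximable_sum approximable_restrict_plane approximable_cmult approximable_entire
        entire_coord) auto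
  thus "approximable (S_upto T) (\<lambda>z. cnj (coord \<tau> z))"
    by (rule approximable_cong, intro sum_over_planes)
       (use C_nonzero in \<open>auto simp: S_upto_def plane_def\<close>)
  have "approximable (S_upto T) (\<lambda>z. \<Sum>c\<in>C. if z \<in> plane \<tau> c then cnj c * coord \<tau> z else 0)"
    by (intro approximable_sum approximable_restrict_plane approximable_cmult approximable_entire
        entire_coord) auto
  thus "approximable (S_upto T) (\<lambda>z. cnj (coord (cnj \<tau>) z))"
    by (rule approximable_cong, intro sum_over_planes) (auto simp: S_upto_def plane_def)
qed

lemma approximable_cnj_component: "approximable (S_upto T) (\<lambda>z. cnj (z $ i))"
proof -
  have "i = 1 \<or> i = 2" by (rule exhaust_2)
  moreover have "approximable (S_upto T) (\<lambda>z. cnj (z $ 1))"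
    by (rule approximable_cong[OF approximable_cmult[OF approximable_diff[OF
        approximable_cmult[OF approximable_cnj_coord(2), where c = "cnj \<tau>"]
        approximable_cmult[OF approximable_cnj_coord(1), where c = "\<tau>"]], where c = "1 / (cnj \<tau> - \<tau>)"]])
       (simp add: components_from_coords(1)[OF Im_tau])
  moreover have "approximable (S_upto T) (\<lambda>z. cnj (z $ 2))"
    by (rule approximable_cong[OF approximable_cmult[OF approximable_diff[OF
        approximable_cnj_coord(1) approximable_cnj_coord(2)], where c = "1 / (cnj \<tau> - \<tau>)"]])
       (simp add: components_from_coords(2)[OF Im_tau])
  ultimately show ?thesis by auto
qed

lemma approximable_real_polynomial:
  assumes "real_polynomial_function q"
  shows "approximable (S_upto T) (\<lambda>z. of_real (q z))"
  using assms
proof (induction q rule: real_polynomial_function.induct)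
  case (linear q)
  have basis: "approximable (S_upto T) (\<lambda>z. of_real (z \<bullet> b))" if "b \<in> Basis" for b :: "complex ^ 2"
  proof -
    obtain i u where b: "b = axis i u" "u = 1 \<or> u = \<i>"
      using \<open>b \<in> Basis\<close> by (auto simp: Basis_vec_def Basis_complex_def)
    have z: "approximable (S_upto T) (\<lambda>z. z $ i)" by (intro approximable_entire entire_nth)
    have "approximable (S_upto T) (\<lambda>z. of_real (Re (z $ i)))"
      by (rule approximable_cong[OF approximable_cmult[OF approximable_add[OF z
          approximable_cnj_component[of _ i]], where c = "1/2"]]) (simp add: complex_add_cnj)
    moreover have "approximable (S_upto T) (\<lambda>z. of_real (Im (z $ i)))"
      by (rule approximable_cong[OF approximable_cmult[OF approximable_diff[OF z
          approximable_cnj_component[of _ i]], where c = "1 / (2 * \<i>)"]]) (simp add: complex_diff_cnj complex_eq_iff)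
    ultimately show ?thesis using b by (auto simp: inner_axis inner_complex_def)
  qed
  have q: "q z = (\<Sum>b\<in>Basis. (z \<bullet> b) * q b)" for z
  proof -
    have "q z = q (\<Sum>b\<in>Basis. (z \<bullet> b) *\<^sub>R b)" by (simp add: euclidean_representation)
    also have "\<dots> = (\<Sum>b\<in>Basis. (z \<bullet> b) * q b)"
      using linear by (simp add: bounded_linear.linear linear_sum linear_cmul)
    finally show ?thesis .
  qed
  have "approximable (S_upto T) (\<lambda>z. \<Sum>b\<in>Basis. of_real (q b) * of_real (z \<bullet> b))"
    by (intro approximable_sum approximable_cmult basis)
  thus ?case
    by (rule approximable_cong, subst q) (simp add: mult.commute)
next
  case (const c)
  show ?case by (rule approximable_const)
next
  case (add f g)
  thus ?case using approximable_add by simp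
next
  case (mult f g)
  thus ?case using approximable_mult[OF compact_S_upto] by simp
qed

lemma approximable_continuous:
  assumes f: "continuous_on (S_upto T) f"
  shows "approximable (S_upto T) f"
proof -
  have real: "approximable (S_upto T) (\<lambda>z. of_real (h z))" if h: "continuous_on (S_upto T) h" for h
  proof (rule approximable_limit)
    fix e :: real assume "e > 0"
    then obtain q where q: "real_polynomial_function q" "\<And>z. z \<in> S_upto T \<Longrightarrow> \<bar>h z - q z\<bar> < e"
      using Stone_Weierstrass_real_polynomial_function[OF compact_S_upto h] by blast
    have "cmod (of_real (q z) - of_real (h z)) \<le> e" if "z \<in> S_upto T" for z
      using q(2)[OF that] unfolding of_real_diff[symmetric] norm_of_real by linarith
    thus "\<exists>g. approximable (S_upto T) g \<and> (\<forall>z\<in>S_upto T. cmod (g z - of_real (h z)) \<le> e)"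
      using approximable_real_polynomial[OF q(1)] by (intro exI[of _ "\<lambda>z. of_real (q z)"]) auto
  qed
  have "approximable (S_upto T) (\<lambda>z. of_real (Re (f z)) + \<i> * of_real (Im (f z)))"
    using f by (intro approximable_add approximable_cmult real continuous_intros)
  thus ?thesis by (simp add: complex_eq[symmetric])
qed
end

section \<open>Carleman approximation over distinct rays\<close>

text \<open>The roots of unity of order \<open>m + 1\<close> are pairwise at least \<open>2 c\<close> apart, and \<open>m\<close> points
  cannot come within \<open>c\<close> of all of them. The constant depends on the cardinality only, which matters
  below, where the set varies with an exponent.\<close>

lemma unit_far_from_finite_set:
  "\<exists>c>0. \<forall>U :: complex set. finite U \<longrightarrow> card U \<le> m \<longrightarrow> (\<exists>\<omega>. cmod \<omega> = 1 \<and> (\<forall>u\<in>U. c \<le> cmod (\<omega> - u)))"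
proof -
  define \<Omega> where "\<Omega> = {z :: complex. z ^ Suc m = 1}"
  have card: "card \<Omega> = Suc m" unfolding \<Omega>_def by (rule card_roots_unity_eq) simp
  hence fin: "finite \<Omega>" using card.infinite by fastforce
  have unit: "cmod \<omega> = 1" if "\<omega> \<in> \<Omega>" for \<omega>
    using that power_eq_imp_eq_norm[of \<omega> "Suc m" 1] unfolding \<Omega>_def by simp
  have "\<exists>d>0. \<forall>x\<in>\<Omega>. x \<noteq> a \<longrightarrow> d \<le> dist a x" for a using finite_set_avoid[OF fin] by blast
  then obtain d where d: "\<And>a. d a > 0" "\<And>a x. x \<in> \<Omega> \<Longrightarrow> x \<noteq> a \<Longrightarrow> d a \<le> dist a x" by metis
  define c where "c = Min (d ` \<Omega>) / 2"
  have ne: "\<Omega> \<noteq> {}" using card by auto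
  have c: "c > 0" "\<And>x y. x \<in> \<Omega> \<Longrightarrow> y \<in> \<Omega> \<Longrightarrow> x \<noteq> y \<Longrightarrow> 2 * c \<le> dist x y"
    using fin ne d by (auto simp: c_def intro: order_trans[OF Min_le])
  have "\<exists>\<omega>. cmod \<omega> = 1 \<and> (\<forall>u\<in>U. c \<le> cmod (\<omega> - u))" if U: "finite U" "card U \<le> m" for U
  proof (rule ccontr)
    assume "\<not> ?thesis"
    hence "\<forall>\<omega>\<in>\<Omega>. \<exists>u\<in>U. cmod (\<omega> - u) < c" using unit not_le by blast
    then obtain g where g: "\<And>\<omega>. \<omega> \<in> \<Omega> \<Longrightarrow> g \<omega> \<in> U" "\<And>\<omega>. \<omega> \<in> \<Omega> \<Longrightarrow> dist \<omega> (g \<omega>) < c"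
      unfolding dist_norm by metis
    have "inj_on g \<Omega>"
    proof (rule inj_onI, rule ccontr)
      fix x y assume xy: "x \<in> \<Omega>" "y \<in> \<Omega>" "g x = g y" "x \<noteq> y"
      have "dist x y \<le> dist x (g x) + dist y (g y)" using dist_triangle2[of x y "g x"] xy by simp
      thus False using c(2)[of x y] g(2)[of x] g(2)[of y] xy by simp
    qed
    moreover have "g ` \<Omega> \<subseteq> U" using g by auto
    ultimately have "card \<Omega> \<le> card U" using U card_inj_on_le by blast
    thus False using card U by simp
  qed
  thus ?thesis using c by blast
qed

context pencil
begin

abbreviation D_upto :: "real \<Rightarrow> real \<Rightarrow> (complex ^ 2) set" where
  "D_upto s L \<equiv> {z. cmod (p z) \<le> s \<and> norm z \<le> L}"

lemma compact_D_upto: "compact (D_upto s L)"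
proof -
  have "D_upto s L = cball 0 L \<inter> {z. cmod (p z) \<le> s}" by auto
  thus ?thesis by (simp only:) (intro compact_Int_closed closed_Collect_le continuous_intros compact_cball)
qed

text \<open>The cut-off is \<open>y / (y - 1)\<close> with \<open>y = (p / s1) ^ n / \<omega>\<close> and \<open>s < s1 < s'\<close>: for large \<open>n\<close> it is
  close to \<open>0\<close> where \<open>\<bar>p\<bar> \<le> s\<close> and close to \<open>1\<close> where \<open>\<bar>p\<bar> \<ge> s'\<close>. Its poles lie on \<open>\<bar>p\<bar> = s1\<close>; the unit
  number \<open>\<omega>\<close> is chosen, depending on \<open>n\<close>, so that they stay off the rays and the cut-off is bounded on
  \<open>S\<close> independently of \<open>n\<close>. The segments from \<open>0\<close> to the values of \<open>y\<close> keep a distance from \<open>1\<close>, so the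
  poles can be pushed to infinity.\<close>

lemma cutoff:
  assumes s: "0 \<le> s" "s < s'"
  shows "\<exists>B>0. \<forall>e>0. \<exists>H. approximable (D_upto s L \<union> S_upto T) H \<and>
      (\<forall>z. cmod (p z) \<le> s \<longrightarrow> cmod (H z) \<le> e) \<and>
      (\<forall>z\<in>S. cmod (H z) \<le> B) \<and> (\<forall>z\<in>S. s' \<le> cmod (p z) \<longrightarrow> cmod (H z - 1) \<le> e)"
proof -
  obtain c where c: "c > 0" "\<And>U :: complex set. finite U \<Longrightarrow> card U \<le> card C \<Longrightarrow>
      \<exists>\<omega>. cmod \<omega> = 1 \<and> (\<forall>u\<in>U. c \<le> cmod (\<omega> - u))"
    using unit_far_from_finite_set[of "card C"] by blast
  define s1 where "s1 = (s + s') / 2"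
  have s1: "0 < s1" "s < s1" "s1 < s'" using s by (auto simp: s1_def)
  have "\<exists>H. approximable (D_upto s L \<union> S_upto T) H \<and> (\<forall>z. cmod (p z) \<le> s \<longrightarrow> cmod (H z) \<le> e) \<and>
      (\<forall>z\<in>S. cmod (H z) \<le> 1 + 2 / c) \<and> (\<forall>z\<in>S. s' \<le> cmod (p z) \<longrightarrow> cmod (H z - 1) \<le> e)"
    if e: "e > 0" for e
  proof -
    have "(\<lambda>n. (s / s1) ^ n) \<longlonglongrightarrow> 0" using s s1 by (intro LIMSEQ_power_zero) auto
    hence "\<forall>\<^sub>F n in sequentially. (s / s1) ^ n < min (1/2) (e/2)"
      using e by (intro order_tendstoD) auto
    moreover have "filterlim (\<lambda>n. (s' / s1) ^ n) at_top sequentially"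
      using s1 by real_asymp
    hence "\<forall>\<^sub>F n in sequentially. (s' / s1) ^ n \<ge> 1 + 1 / e" by (simp add: filterlim_at_top)
    ultimately have "\<forall>\<^sub>F n in sequentially. (s / s1) ^ n < min (1/2) (e/2) \<and> (s' / s1) ^ n \<ge> 1 + 1 / e"
      by eventually_elim auto
    then obtain n where n: "(s / s1) ^ n < min (1/2) (e/2)" "(s' / s1) ^ n \<ge> 1 + 1 / e"
      unfolding eventually_sequentially by blast
    have "card ((\<lambda>c. sgn c ^ n) ` C) \<le> card C" by (rule card_image_le[OF finite_C])
    then obtain \<omega> where \<omega>: "cmod \<omega> = 1" "\<And>d. d \<in> C \<Longrightarrow> c \<le> cmod (\<omega> - sgn d ^ n)"
      using c(2)[of "(\<lambda>c. sgn c ^ n) ` C"] finite_C by auto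
    have \<omega>0: "\<omega> \<noteq> 0" using \<omega> by auto
    (* far_from_ray, applied to the rays through the n-th powers, keeps S away from the poles. *)
    define y where "y = (\<lambda>z. 1 / (of_real (s1 ^ n) * \<omega>) * p z ^ n)"
    have ny: "cmod (y z) = (cmod (p z) / s1) ^ n" for z
      using s1 \<omega> by (simp add: y_def norm_mult norm_divide norm_power power_divide)
    have y_small: "cmod (y z) < min (1/2) (e/2)" if "cmod (p z) \<le> s" for z
    proof -
      have "(cmod (p z) / s1) ^ n \<le> (s / s1) ^ n"
        using that s1 by (intro power_mono divide_right_mono) auto
      thus ?thesis using n(1) ny by simp
    qed
    have y_S: "c / 2 \<le> cmod (1 - of_real r * y z)" if z: "z \<in> S" and r: "r \<ge> 0" for z r
    proof -
      obtain d where d: "d \<in> C" "p z = of_real (cmod (p z)) * sgn d" using p_polar_S[OF z] .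
      define \<rho> where "\<rho> = r * (cmod (p z) / s1) ^ n"
      have "p z ^ n = of_real (cmod (p z) ^ n) * sgn d ^ n"
        by (subst d(2)) (simp add: power_mult_distrib)
      hence "1 - of_real r * y z = (\<omega> - of_real \<rho> * sgn d ^ n) / \<omega>"
        using \<omega>0 s1 by (simp add: y_def \<rho>_def power_divide field_simps)
      hence "cmod (1 - of_real r * y z) = cmod (\<omega> - of_real \<rho> * sgn d ^ n)"
        using \<omega> by (simp add: norm_divide)
      moreover have "cmod (\<omega> - sgn d ^ n) \<le> 2 * cmod (\<omega> - of_real \<rho> * sgn d ^ n)"
        using r s1 by (intro far_from_ray \<omega>(1)) (auto simp: \<rho>_def norm_power norm_sgn_C[OF d(1)])
      ultimately show ?thesis using \<omega>(2)[OF d(1)] by simp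
    qed
    define H where "H = (\<lambda>z. 1 - 1 / (1 - y z))"
    have "approximable (D_upto s L \<union> S_upto T) (\<lambda>z. 1 / (1 - of_real 1 * y z))"
    proof (rule approximable_inverse)
      show "compact (D_upto s L \<union> S_upto T)" by (intro compact_Un compact_D_upto compact_S_upto)
      show "approximable (D_upto s L \<union> S_upto T) y"
        unfolding y_def by (intro approximable_cmult approximable_entire entire_power entire_quad)
      show "min (1/2) (c/2) > 0" using c by simp
      fix z and r :: real
      assume z: "z \<in> D_upto s L \<union> S_upto T" and r: "0 \<le> r" "r \<le> 1"
      show "min (1/2) (c/2) \<le> cmod (1 - of_real r * y z)"
      proof (cases "z \<in> S")
        case True
        thus ?thesis using y_S r by (auto simp: min_le_iff_disj)
      next
        case False
        hence "cmod (y z) < 1/2" using z y_small[of z] by (auto simp: S_upto_def)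
        hence "r * cmod (y z) \<le> 1 * (1/2)" using r by (intro mult_mono) auto
        thus ?thesis using norm_triangle_ineq2[of 1 "of_real r * y z"] r
          by (simp add: norm_mult)
      qed
    qed auto
    hence "approximable (D_upto s L \<union> S_upto T) H"
      unfolding H_def by (intro approximable_diff approximable_const) simp
    moreover have "cmod (H z) \<le> e" if "cmod (p z) \<le> s" for z
    proof -
      have y: "cmod (y z) < 1/2" "cmod (y z) < e/2" using y_small[OF that] by auto
      hence "1/2 \<le> cmod (1 - y z)" using norm_triangle_ineq2[of 1 "y z"] by simp
      moreover from this have "1 - y z \<noteq> 0" by auto
      hence "H z = - y z / (1 - y z)" by (simp add: H_def field_simps)
      ultimately have "cmod (H z) \<le> (e/2) / (1/2)"
        using y(2) e by (simp only: norm_divide norm_minus_cancel) (intro frac_le, auto)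
      thus ?thesis by simp
    qed
    moreover have "cmod (H z) \<le> 1 + 2 / c" if "z \<in> S" for z
    proof -
      have "c / 2 \<le> cmod (1 - y z)" using y_S[OF that, of 1] by simp
      hence "cmod (1 / (1 - y z)) \<le> 1 / (c/2)"
        using c by (simp only: norm_divide norm_one) (intro frac_le, auto)
      thus ?thesis unfolding H_def using norm_triangle_ineq4[of 1 "1 / (1 - y z)"] by simp
    qed
    moreover have "cmod (H z - 1) \<le> e" if "s' \<le> cmod (p z)" for z
    proof -
      have "(s' / s1) ^ n \<le> (cmod (p z) / s1) ^ n"
        using that s s1 by (intro power_mono divide_right_mono) auto
      hence "1 / e \<le> cmod (1 - y z)"
        using n(2) ny[of z] norm_triangle_ineq2[of "y z" 1] by (simp add: norm_minus_commute)
      hence "1 / cmod (1 - y z) \<le> 1 / (1 / e)" using e by (intro frac_le) auto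
      thus ?thesis by (simp add: H_def norm_divide)
    qed
    ultimately show ?thesis by blast
  qed
  moreover have "1 + 2 / c > 0" using c by (simp add: add_pos_pos)
  ultimately show ?thesis by blast
qed

text \<open>Approximate \<open>b\<close> on the compact piece of \<open>S\<close> by an entire function \<open>a\<close>, about whose size on
  \<open>D_upto s L\<close> nothing is known, and multiply by a cut-off chosen after \<open>a\<close>. Since \<open>b\<close> vanishes where the
  cut-off is not close to \<open>1\<close>, the product still approximates \<open>b\<close>.\<close>

lemma local_approximation:
  assumes s: "0 \<le> s" "s < s'" and b: "continuous_on (S_upto T) b"
    and b0: "\<And>z. z \<in> S_upto T \<Longrightarrow> cmod (p z) \<le> s' \<Longrightarrow> b z = 0" and e: "e > 0"
  obtains h where "entire h" "\<And>z. z \<in> D_upto s L \<Longrightarrow> cmod (h z) < e"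
    "\<And>z. z \<in> S_upto T \<Longrightarrow> cmod (h z - b z) < e"
proof -
  let ?K = "D_upto s L \<union> S_upto T"
  have K: "compact ?K" by (intro compact_Un compact_D_upto compact_S_upto)
  obtain B where B: "B > 0" "\<And>e. e > 0 \<Longrightarrow> \<exists>H. approximable ?K H \<and>
      (\<forall>z. cmod (p z) \<le> s \<longrightarrow> cmod (H z) \<le> e) \<and>
      (\<forall>z\<in>S. cmod (H z) \<le> B) \<and> (\<forall>z\<in>S. s' \<le> cmod (p z) \<longrightarrow> cmod (H z - 1) \<le> e)"
    using cutoff[OF s] by blast
  have "e / (4 * B) > 0" using B e by simp
  then obtain a where a: "entire a" "\<And>z. z \<in> S_upto T \<Longrightarrow> cmod (a z - b z) < e / (4 * B)"
    using approximableE[OF approximable_continuous[OF b]] by blast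
  obtain N1 where N1: "N1 > 0" "\<And>z. z \<in> ?K \<Longrightarrow> cmod (a z) \<le> N1"
    using approximable_bounded[OF K approximable_entire[OF a(1)]] by blast
  obtain N2 where N2: "N2 > 0" "\<And>z. z \<in> S_upto T \<Longrightarrow> cmod (b z) \<le> N2"
    using approximable_bounded[OF compact_S_upto approximable_continuous[OF b]] by blast
  define N where "N = N1 + N2"
  have N: "N > 0" "\<And>z. z \<in> ?K \<Longrightarrow> cmod (a z) \<le> N" "\<And>z. z \<in> S_upto T \<Longrightarrow> cmod (b z) \<le> N"
    unfolding N_def using N1 N2 by (simp, intro add_increasing2, simp_all, intro add_increasing, simp_all)
  define d where "d = e / (4 * N)"
  have d: "d > 0" using N e by (simp add: d_def)
  obtain H where H: "approximable ?K H" "\<And>z. cmod (p z) \<le> s \<Longrightarrow> cmod (H z) \<le> d"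
      "\<And>z. z \<in> S \<Longrightarrow> cmod (H z) \<le> B" "\<And>z. z \<in> S \<Longrightarrow> s' \<le> cmod (p z) \<Longrightarrow> cmod (H z - 1) \<le> d"
    using B(2)[OF d] by blast
  obtain q where q: "entire q" "\<And>z. z \<in> ?K \<Longrightarrow> cmod (q z - H z) < d"
    using approximableE[OF H(1) d] by blast
  have "entire (\<lambda>z. a z * q z)" by (intro entire_mult a q)
  moreover have "cmod (a z * q z) < e" if z: "z \<in> D_upto s L" for z
  proof -
    have "cmod (q z) \<le> d + d"
      using norm_triangle_ineq[of "q z - H z" "H z"] q(2)[of z] H(2)[of z] z by auto
    hence "cmod (a z) * cmod (q z) \<le> N * (d + d)" using N z by (intro mult_mono) auto
    thus ?thesis using N(1) e by (simp add: norm_mult d_def)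
  qed
  moreover have "cmod (a z * q z - b z) < e" if z: "z \<in> S_upto T" for z
  proof -
    have zS: "z \<in> S" using z by (simp add: S_upto_def)
    have "cmod (a z * (q z - H z)) \<le> N * d"
      unfolding norm_mult using N z q(2)[of z] by (intro mult_mono) auto
    moreover have "cmod ((a z - b z) * H z) \<le> e / (4 * B) * B"
      unfolding norm_mult using a(2)[OF z] H(3)[OF zS] B(1) e by (intro mult_mono) auto
    moreover have "cmod (b z * (H z - 1)) \<le> N * d"
    proof (cases "cmod (p z) \<le> s'")
      case False
      thus ?thesis unfolding norm_mult using N z H(4)[OF zS] by (intro mult_mono) auto
    qed (use b0 z N d in simp)
    moreover have "a z * q z - b z = a z * (q z - H z) + (a z - b z) * H z + b z * (H z - 1)"
      by (simp add: algebra_simps)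
    ultimately have "cmod (a z * q z - b z) \<le> N * d + e / (4 * B) * B + N * d"
      by (metis add_mono norm_triangle_le)
    also have "\<dots> < e" using N(1) B(1) e by (simp add: d_def)
    finally show ?thesis .
  qed
  ultimately show ?thesis using that by blast
qed

lemma S_upto_subset: "S_upto T \<subseteq> S"
  by (auto simp: S_upto_def)

text \<open>Inductive step of the exhaustion: correct the error of \<open>G\<close> on the next shell. The correction
  starts in the middle of the shell \<open>k \<le> \<bar>p\<bar> \<le> k + 1\<close>, where the error of \<open>G\<close> is already small, and is
  negligible on the earlier pieces of \<open>S\<close> and on a large compact set.\<close>

lemma Carleman_step:
  fixes k :: nat
  assumes f: "continuous_on S f" and G: "entire G" and \<eta>: "\<eta>' > 0" "\<eta> > 0"
    and fG: "\<And>z. z \<in> S \<Longrightarrow> real k \<le> cmod (p z) \<Longrightarrow> cmod (p z) \<le> real k + 1 \<Longrightarrow> cmod (f z - G z) < \<eta>"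
  shows "\<exists>G'. entire G' \<and>
    (\<forall>z. cmod (p z) \<le> real k \<longrightarrow> norm z \<le> real k \<longrightarrow> cmod (G' z - G z) < \<eta>') \<and>
    (\<forall>z\<in>S. cmod (p z) \<le> real k \<longrightarrow> cmod (G' z - G z) < \<eta>') \<and>
    (\<forall>z\<in>S. real k \<le> cmod (p z) \<longrightarrow> cmod (p z) \<le> real k + 1 \<longrightarrow> cmod (f z - G' z) < \<eta> + \<eta>') \<and>
    (\<forall>z\<in>S. real k + 1 \<le> cmod (p z) \<longrightarrow> cmod (p z) \<le> real k + 2 \<longrightarrow> cmod (f z - G' z) < \<eta>')"
proof -
  obtain L0 where L0: "\<And>z. z \<in> S_upto (real k) \<Longrightarrow> norm z \<le> L0"
    using compact_imp_bounded[OF compact_S_upto] unfolding bounded_iff by blast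
  define \<psi> where "\<psi> = (\<lambda>z. min 1 (max 0 (2 * (cmod (p z) - real k) - 1)))"
  have \<psi>: "0 \<le> \<psi> z" "\<psi> z \<le> 1" for z by (auto simp: \<psi>_def)
  define b where "b = (\<lambda>z. of_real (\<psi> z) * (f z - G z))"
  have "continuous_on (S_upto (real k + 2)) b"
    unfolding b_def \<psi>_def
    by (intro continuous_intros continuous_on_subset[OF f S_upto_subset] entire_continuous_on G)
  moreover have "b z = 0" if "cmod (p z) \<le> real k + 1/2" for z
    using that by (simp add: b_def \<psi>_def)
  ultimately obtain h where h: "entire h"
    "\<And>z. z \<in> D_upto (real k) (max L0 (real k)) \<Longrightarrow> cmod (h z) < \<eta>'"
    "\<And>z. z \<in> S_upto (real k + 2) \<Longrightarrow> cmod (h z - b z) < \<eta>'"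
    using local_approximation[of "real k" "real k + 1/2" "real k + 2" b \<eta>' "max L0 (real k)"] \<eta>
    by (auto simp: S_upto_def)
  have hb: "cmod (h z - b z) < \<eta>'" if "z \<in> S" "cmod (p z) \<le> real k + 2" for z
    using h(3)[of z] that by (simp add: S_upto_def)
  show ?thesis
  proof (intro exI[of _ "\<lambda>z. G z + h z"] conjI allI ballI impI)
    show "entire (\<lambda>z. G z + h z)" by (intro entire_add G h)
  next
    fix z assume "cmod (p z) \<le> real k" "norm z \<le> real k"
    thus "cmod (G z + h z - G z) < \<eta>'" using h(2)[of z] by simp
  next
    fix z assume "z \<in> S" "cmod (p z) \<le> real k"
    thus "cmod (G z + h z - G z) < \<eta>'" using h(2)[of z] L0[of z] by (simp add: S_upto_def max.coboundedI1)
  next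
    fix z assume z: "z \<in> S" "real k \<le> cmod (p z)" "cmod (p z) \<le> real k + 1"
    have "f z - (G z + h z) = of_real (1 - \<psi> z) * (f z - G z) + (b z - h z)"
      by (simp add: b_def algebra_simps)
    hence "cmod (f z - (G z + h z)) \<le> cmod (of_real (1 - \<psi> z) * (f z - G z)) + cmod (b z - h z)"
      by (metis norm_triangle_ineq)
    also have "cmod (of_real (1 - \<psi> z) * (f z - G z)) \<le> 1 * cmod (f z - G z)"
      unfolding norm_mult norm_of_real using \<psi>[of z] by (intro mult_right_mono) auto
    finally show "cmod (f z - (G z + h z)) < \<eta> + \<eta>'"
      using fG[OF z] hb[of z] z by (simp add: norm_minus_commute)
  next
    fix z assume z: "z \<in> S" "real k + 1 \<le> cmod (p z)" "cmod (p z) \<le> real k + 2"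
    hence "\<psi> z = 1" by (simp add: \<psi>_def)
    hence "f z - (G z + h z) = - (h z - b z)" by (simp add: b_def)
    thus "cmod (f z - (G z + h z)) < \<eta>'" using hb[of z] z by (simp only: norm_minus_cancel)
  qed
qed

text \<open>The tolerances \<open>\<eta> l\<close> decay geometrically and relative to the minimum of \<open>\<epsilon>\<close> on the \<open>l\<close>-th piece, so
  at each point the errors of all later steps add up to less than \<open>\<epsilon>\<close> there.\<close>

theorem Carleman_approximation: "allows_Carleman_approximation S"
  unfolding allows_Carleman_approximation_def
proof (intro conjI closed_S allI impI)
  fix f :: "complex ^ 2 \<Rightarrow> complex" and \<epsilon> :: "complex ^ 2 \<Rightarrow> real"
  assume f: "continuous_on S f" and \<epsilon>: "continuous_on S \<epsilon>" and pos: "\<forall>z\<in>S. 0 < \<epsilon> z"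
  have "\<exists>m>0. \<forall>z\<in>S_upto (real l + 1). m \<le> \<epsilon> z" for l :: nat
  proof (cases "S_upto (real l + 1) = {}")
    case False
    obtain y where "y \<in> S_upto (real l + 1)" "\<And>z. z \<in> S_upto (real l + 1) \<Longrightarrow> \<epsilon> y \<le> \<epsilon> z"
      using continuous_attains_inf[OF compact_S_upto False continuous_on_subset[OF \<epsilon> S_upto_subset]]
      by blast
    thus ?thesis using pos S_upto_subset by blast
  qed (auto intro: exI[of _ 1])
  then obtain m where m: "\<And>l::nat. m l > 0" "\<And>l z. z \<in> S_upto (real l + 1) \<Longrightarrow> m l \<le> \<epsilon> z"
    by metis
  define \<eta> where "\<eta> = (\<lambda>l. (1/2) ^ (l + 2) * min 1 (m l))"
  have \<eta>: "\<eta> l > 0" "\<eta> l \<le> (1/2) ^ (l + 2)" for l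
    using m(1)[of l] by (auto simp: \<eta>_def mult_le_cancel_left1)
  have \<eta>\<epsilon>: "\<eta> l \<le> (1/2) ^ (l + 2) * \<epsilon> z" if "z \<in> S" "cmod (p z) \<le> real l + 1" for l z
    unfolding \<eta>_def using m(2)[of z l] that by (intro mult_left_mono) (auto simp: S_upto_def)
  define P where "P = (\<lambda>k G. entire G \<and>
    (\<forall>z\<in>S. real k \<le> cmod (p z) \<longrightarrow> cmod (p z) \<le> real k + 1 \<longrightarrow> cmod (f z - G z) < \<eta> k))"
  define Q where "Q = (\<lambda>k G G'.
    (\<forall>z. cmod (p z) \<le> real k \<longrightarrow> norm z \<le> real k \<longrightarrow> cmod (G' z - G z) < \<eta> (Suc k)) \<and>
    (\<forall>z\<in>S. cmod (p z) \<le> real k \<longrightarrow> cmod (G' z - G z) < \<eta> (Suc k)) \<and>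
    (\<forall>z\<in>S. real k \<le> cmod (p z) \<longrightarrow> cmod (p z) \<le> real k + 1 \<longrightarrow> cmod (f z - G' z) < \<eta> k + \<eta> (Suc k)))"
  have "\<exists>G. \<forall>k. P k (G k) \<and> Q k (G k) (G (Suc k))"
  proof (rule dependent_nat_choice)
    have "approximable (S_upto 1) f"
      by (intro approximable_continuous continuous_on_subset[OF f S_upto_subset])
    then obtain G where "entire G" "\<And>z. z \<in> S_upto 1 \<Longrightarrow> cmod (G z - f z) < \<eta> 0"
      using approximableE \<eta>(1)[of 0] by blast
    thus "\<exists>G. P 0 G"
      unfolding P_def by (intro exI[of _ G]) (auto simp: S_upto_def norm_minus_commute)
  next
    fix G k assume "P k G"
    hence "\<exists>G'. entire G' \<and>
      (\<forall>z. cmod (p z) \<le> real k \<longrightarrow> norm z \<le> real k \<longrightarrow> cmod (G' z - G z) < \<eta> (Suc k)) \<and>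
      (\<forall>z\<in>S. cmod (p z) \<le> real k \<longrightarrow> cmod (G' z - G z) < \<eta> (Suc k)) \<and>
      (\<forall>z\<in>S. real k \<le> cmod (p z) \<longrightarrow> cmod (p z) \<le> real k + 1 \<longrightarrow> cmod (f z - G' z) < \<eta> k + \<eta> (Suc k)) \<and>
      (\<forall>z\<in>S. real k + 1 \<le> cmod (p z) \<longrightarrow> cmod (p z) \<le> real k + 2 \<longrightarrow> cmod (f z - G' z) < \<eta> (Suc k))"
      unfolding P_def by (intro Carleman_step f \<eta>(1)) auto
    thus "\<exists>G'. P (Suc k) G' \<and> Q k G G'" unfolding P_def Q_def by (auto simp: add_ac)
  qed
  then obtain G where P: "\<And>k. P k (G k)" and Q: "\<And>k. Q k (G k) (G (Suc k))" by blast
  have "\<exists>N. \<forall>l\<ge>N. \<forall>z. norm z \<le> R \<longrightarrow> cmod (G (Suc l) z - G l z) \<le> (1/2) ^ l" for R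
  proof -
    obtain B where B: "\<And>z. norm z \<le> R \<Longrightarrow> cmod (p z) \<le> B"
      using approximable_bounded[OF compact_cball[of 0 R] approximable_entire[OF entire_quad]]
      by (metis mem_cball_0)
    obtain N :: nat where N: "real N > max R B" using reals_Archimedean2 by blast
    have "cmod (G (Suc l) z - G l z) \<le> (1/2) ^ l" if "l \<ge> N" "norm z \<le> R" for l z
    proof -
      have "cmod (G (Suc l) z - G l z) < \<eta> (Suc l)"
        using Q[of l] B[of z] N that unfolding Q_def by auto
      also have "\<dots> \<le> (1/2) ^ (Suc l + 2)" by (rule \<eta>)
      also have "\<dots> \<le> (1/2) ^ l" by (intro power_decreasing) auto
      finally show ?thesis by simp
    qed
    thus ?thesis by blast
  qed
  then obtain g where g: "entire g" "\<And>z. (\<lambda>l. G l z) \<longlonglongrightarrow> g z"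
    using entire_limit[of G] P unfolding P_def by blast
  have "cmod (f z - g z) < \<epsilon> z" if z: "z \<in> S" for z
  proof -
    define k where "k = nat \<lfloor>cmod (p z)\<rfloor>"
    have k: "real k \<le> cmod (p z)" "cmod (p z) \<le> real k + 1"
      using norm_ge_zero[of "p z"] unfolding k_def by linarith+
    have \<epsilon>z: "\<epsilon> z > 0" using pos z by simp
    have bound: "cmod (f z - G l z) \<le> ((1/2) ^ (k + 1) - (1/2) ^ (l + 2)) * \<epsilon> z" if "l \<ge> Suc k" for l
      using that
    proof (induction l rule: dec_induct)
      case base
      have "cmod (f z - G (Suc k) z) < \<eta> k + \<eta> (Suc k)"
        using Q[of k] z k unfolding Q_def by auto
      also have "\<dots> \<le> (1/2) ^ (k + 2) * \<epsilon> z + (1/2) ^ (Suc k + 2) * \<epsilon> z"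
        using k by (intro add_mono \<eta>\<epsilon> z) auto
      finally show ?case by (simp add: algebra_simps)
    next
      case (step l)
      have "cmod (G (Suc l) z - G l z) < \<eta> (Suc l)"
        using Q[of l] z k step unfolding Q_def by auto
      also have "\<dots> \<le> (1/2) ^ (Suc l + 2) * \<epsilon> z"
        using k step by (intro \<eta>\<epsilon> z) auto
      finally have "cmod (f z - G (Suc l) z) \<le>
          ((1/2) ^ (k + 1) - (1/2) ^ (l + 2)) * \<epsilon> z + (1/2) ^ (Suc l + 2) * \<epsilon> z"
        using step.IH norm_triangle_ineq4[of "f z - G l z" "G (Suc l) z - G l z"] by simp
      thus ?case by (simp add: algebra_simps)
    qed
    have "cmod (f z - g z) \<le> \<epsilon> z / 2"
    proof (rule LIMSEQ_le_const2)
      show "(\<lambda>l. cmod (f z - G l z)) \<longlonglongrightarrow> cmod (f z - g z)" by (intro tendsto_intros g)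
      have "((1/2) ^ (k + 1) - (1/2) ^ (l + 2)) * \<epsilon> z \<le> (1/2) * \<epsilon> z" for l
      proof (intro mult_right_mono)
        have "(1/2::real) ^ (k + 1) \<le> (1/2) ^ 1" by (intro power_decreasing) auto
        thus "(1/2::real) ^ (k + 1) - (1/2) ^ (l + 2) \<le> 1/2"
          unfolding power_one_right by (rule order_trans[rotated]) simp
      qed (use \<epsilon>z in simp)
      hence "cmod (f z - G l z) \<le> 1/2 * \<epsilon> z" if "l \<ge> Suc k" for l
        using bound[OF that] order_trans by blast
      thus "\<exists>N. \<forall>l\<ge>N. cmod (f z - G l z) \<le> \<epsilon> z / 2"
        by (intro exI[of _ "Suc k"] allI impI) simp
    qed
    thus ?thesis using \<epsilon>z by simp
  qed
  thus "\<exists>g. entire g \<and> (\<forall>z\<in>S. cmod (f z - g z) < \<epsilon> z)" using g(1) by blast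
qed
end

section \<open>Two planes over the same ray\<close>

text \<open>The inverse of the coordinate map.\<close>

definition point :: "complex \<Rightarrow> complex \<Rightarrow> complex \<Rightarrow> complex ^ 2" where
  "point \<tau> a b = vector [(\<tau> * b - cnj \<tau> * a) / (\<tau> - cnj \<tau>), (a - b) / (\<tau> - cnj \<tau>)]"

lemma coord_point:
  assumes "Im \<tau> \<noteq> 0"
  shows "coord \<tau> (point \<tau> a b) = a" "coord (cnj \<tau>) (point \<tau> a b) = b"
proof -
  have "\<tau> - cnj \<tau> \<noteq> 0" using assms by (simp add: complex_eq_iff)
  moreover have "coord \<sigma> (point \<tau> a b) =
      ((\<tau> - \<sigma>) * b + (\<sigma> - cnj \<tau>) * a) / (\<tau> - cnj \<tau>)" for \<sigma>
    by (simp add: coord_def point_def algebra_simps flip: add_divide_distrib)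
  ultimately show "coord \<tau> (point \<tau> a b) = a" "coord (cnj \<tau>) (point \<tau> a b) = b" by simp_all
qed

text \<open>If \<open>c = t d\<close> with \<open>t > 0\<close>, the curve on which the product of the coordinates equals \<open>d\<close> meets both
  planes in circles, of radius \<open>1\<close> and \<open>1 / sqrt t\<close> in the first coordinate. The mean of an entire
  function over such a circle does not depend on the radius, so no entire function is close to
  the distance-like function \<open>f\<close>, which vanishes on one circle and is a positive constant on the other.\<close>

lemma not_Carleman_same_ray:
  assumes \<tau>: "Im \<tau> \<noteq> 0" and c: "c = of_real t * d" "t > 0" "c \<noteq> d"
    and sub: "plane \<tau> c \<subseteq> S" "plane \<tau> d \<subseteq> S"
  shows "\<not> allows_Carleman_approximation S"
proof
  assume "allows_Carleman_approximation S"
  define r where "r = 1 / sqrt t"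
  have r: "r > 0" "t * r\<^sup>2 = 1" using c by (auto simp: r_def power_divide)
  define a where "a = cmod (c - d) * r"
  have a: "a > 0" using c r by (simp add: a_def)
  define f where "f = (\<lambda>z. complex_of_real (cmod (coord (cnj \<tau>) z - d * cnj (coord \<tau> z))))"
  have "continuous_on S f" unfolding f_def by (intro continuous_intros)
  moreover have "continuous_on S (\<lambda>_. a / 4)" by simp
  ultimately obtain g where g: "entire g" "\<And>z. z \<in> S \<Longrightarrow> cmod (f z - g z) < a / 4"
    using \<open>allows_Carleman_approximation S\<close> a unfolding allows_Carleman_approximation_def
    by (metis zero_less_divide_iff zero_less_numeral)
  define \<gamma> where "\<gamma> = (\<lambda>\<zeta>. point \<tau> \<zeta> (d / \<zeta>))"
  define h where "h = (\<lambda>\<zeta>. g (\<gamma> \<zeta>) / \<zeta>)"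
  have "(\<lambda>\<zeta>. g (\<gamma> \<zeta>)) holomorphic_on (UNIV - {0})"
    unfolding holomorphic_on_def
  proof
    fix \<zeta> :: complex assume \<zeta>: "\<zeta> \<in> UNIV - {0}"
    have ne: "\<tau> - cnj \<tau> \<noteq> 0" using \<tau> by (simp add: complex_eq_iff)
    obtain D where D: "(g has_derivative D) (at (\<gamma> \<zeta>))" using g(1) unfolding entire_def by blast
    define v where "v = (\<chi> i. deriv (\<lambda>\<zeta>. \<gamma> \<zeta> $ i) \<zeta>)"
    have "((\<lambda>\<zeta>. \<gamma> \<zeta> $ i) has_field_derivative v $ i) (at \<zeta>)" for i
    proof -
      have "i = 1 \<or> i = 2" by (rule exhaust_2)
      hence "(\<lambda>\<zeta>. \<gamma> \<zeta> $ i) holomorphic_on (UNIV - {0})"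
        using ne unfolding \<gamma>_def point_def by (auto intro!: holomorphic_intros)
      from holomorphic_derivI[OF this open_delete[OF open_UNIV] \<zeta>, of UNIV]
      show ?thesis by (simp add: v_def)
    qed
    from entire_compose_curve[OF g(1) D this]
    show "(\<lambda>\<zeta>. g (\<gamma> \<zeta>)) field_differentiable at \<zeta> within UNIV - {0}"
      unfolding field_differentiable_def using has_field_derivative_at_within by blast
  qed
  hence hol: "h holomorphic_on (UNIV - {0})"
    unfolding h_def by (intro holomorphic_intros) auto
  define I where "I = 2 * pi * \<i> * residue h 0"
  have I: "(h has_contour_integral I) (circlepath 0 \<rho>)" if "\<rho> > 0" for \<rho>
    unfolding I_def using hol that by (intro base_residue[of UNIV]) auto
  have I1: "cmod I \<le> a / 4 * (2 * pi * 1)"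
  proof (rule has_contour_integral_bound_circlepath[OF I])
    fix \<zeta> :: complex assume \<zeta>: "cmod (\<zeta> - 0) = 1"
    hence "\<zeta> * cnj \<zeta> = 1" by (simp add: complex_norm_square[symmetric])
    hence "d / \<zeta> = d * (\<zeta> * cnj \<zeta>) / \<zeta>" by simp
    also have "\<dots> = d * cnj \<zeta>" using \<zeta> by auto
    finally have "d / \<zeta> = d * cnj \<zeta>" .
    hence *: "coord (cnj \<tau>) (\<gamma> \<zeta>) = d * cnj (coord \<tau> (\<gamma> \<zeta>))" by (simp add: \<gamma>_def coord_point[OF \<tau>])
    hence "\<gamma> \<zeta> \<in> S" using sub by (auto simp: plane_def)
    moreover have "f (\<gamma> \<zeta>) = 0" using * by (simp add: f_def)
    ultimately show "cmod (h \<zeta>) \<le> a / 4" using g(2)[of "\<gamma> \<zeta>"] \<zeta> by (simp add: h_def norm_divide)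
  qed (use a in auto)
  have Ir: "cmod (I - 2 * pi * \<i> * of_real a) \<le> (a / 4) / r * (2 * pi * r)"
  proof (rule has_contour_integral_bound_circlepath)
    have "((\<lambda>\<zeta>. of_real a / (\<zeta> - 0)) has_contour_integral 2 * pi * \<i> * of_real a) (circlepath 0 r)"
      using Cauchy_integral_circlepath_simple[of "\<lambda>_. of_real a" 0 r 0] r by simp
    thus "((\<lambda>\<zeta>. h \<zeta> - of_real a / \<zeta>) has_contour_integral (I - 2 * pi * \<i> * of_real a)) (circlepath 0 r)"
      using has_contour_integral_diff[OF I[OF r(1)]] by simp
  next
    fix \<zeta> :: complex assume "cmod (\<zeta> - 0) = r"
    hence \<zeta>: "cmod \<zeta> = r" "\<zeta> \<noteq> 0" using r by auto
    hence "\<zeta> * cnj \<zeta> = of_real (r\<^sup>2)" by (simp add: complex_norm_square[symmetric])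
    hence "c * (\<zeta> * cnj \<zeta>) = of_real (t * r\<^sup>2) * d" unfolding c(1) by simp
    hence "d / \<zeta> = c * cnj \<zeta>" using \<zeta> unfolding r(2) by (simp add: field_simps)
    hence *: "coord (cnj \<tau>) (\<gamma> \<zeta>) = c * cnj (coord \<tau> (\<gamma> \<zeta>))" by (simp add: \<gamma>_def coord_point[OF \<tau>])
    hence "\<gamma> \<zeta> \<in> S" using sub by (auto simp: plane_def)
    moreover have "f (\<gamma> \<zeta>) = of_real (cmod ((c - d) * cnj (coord \<tau> (\<gamma> \<zeta>))))"
      by (simp only: f_def * left_diff_distrib)
    hence "f (\<gamma> \<zeta>) = of_real a"
      using \<zeta> by (simp add: \<gamma>_def coord_point[OF \<tau>] a_def norm_mult)
    ultimately have "cmod (g (\<gamma> \<zeta>) - of_real a) \<le> a / 4"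
      using g(2)[of "\<gamma> \<zeta>"] by (simp add: norm_minus_commute)
    moreover have "h \<zeta> - of_real a / \<zeta> = (g (\<gamma> \<zeta>) - of_real a) / \<zeta>" by (simp add: h_def diff_divide_distrib)
    ultimately show "cmod (h \<zeta> - of_real a / \<zeta>) \<le> (a / 4) / r"
      using \<zeta> r by (simp only: norm_divide) (intro divide_right_mono, auto)
  qed (use a r in auto)
  have "2 * (pi * a) = cmod (2 * pi * \<i> * of_real a)" using a by (simp add: norm_mult)
  also have "\<dots> \<le> cmod I + cmod (I - 2 * pi * \<i> * of_real a)"
    using norm_triangle_ineq4[of I "I - 2 * pi * \<i> * of_real a"] by simp
  also have "\<dots> \<le> a / 4 * (2 * pi * 1) + (a / 4) / r * (2 * pi * r)" by (intro add_mono I1 Ir)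
  also have "\<dots> = pi * a" using r(1) by simp
  finally show False using a by simp
qed

section \<open>Eigencoordinates of the matrices\<close>

lemma matrix_vector_mult_2:
  "((A :: 'a :: semiring_1 ^ 2 ^ 2) *v x) $ i = A $ i $ 1 * x $ 1 + A $ i $ 2 * x $ 2"
  by (simp add: matrix_vector_mult_def sum_2)

lemma discriminant_neg_of_nonreal_spectrum:
  fixes A :: "real ^ 2 ^ 2"
  assumes "spectrum A \<subseteq> UNIV - \<real>"
  shows "(A $ 1 $ 1 - A $ 2 $ 2)\<^sup>2 + 4 * A $ 1 $ 2 * A $ 2 $ 1 < 0"
proof (rule ccontr)
  assume "\<not> ?thesis"
  hence nn: "0 \<le> (A $ 1 $ 1 - A $ 2 $ 2)\<^sup>2 + 4 * A $ 1 $ 2 * A $ 2 $ 1" by simp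
  have "\<exists>x::real. of_real x \<in> spectrum A"
  proof (cases "A $ 1 $ 2 = 0")
    case True
    have "vector [0, 1] \<noteq> (0 :: complex ^ 2)" by (simp add: vec_eq_iff forall_2)
    moreover have "cmatrix A *v vector [0, 1] = of_real (A $ 2 $ 2) *s vector [0, 1]"
      using True by (simp add: vec_eq_iff forall_2 matrix_vector_mult_2 map_matrix_def)
    ultimately show ?thesis unfolding spectrum_def by blast
  next
    case False
    define s where "s = sqrt ((A $ 1 $ 1 - A $ 2 $ 2)\<^sup>2 + 4 * A $ 1 $ 2 * A $ 2 $ 1)"
    define x where "x = (A $ 1 $ 1 + A $ 2 $ 2 + s) / 2"
    have "s\<^sup>2 = (A $ 1 $ 1 - A $ 2 $ 2)\<^sup>2 + 4 * A $ 1 $ 2 * A $ 2 $ 1" using nn by (simp add: s_def)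
    hence x: "A $ 2 $ 1 * A $ 1 $ 2 + A $ 2 $ 2 * (x - A $ 1 $ 1) = x * (x - A $ 1 $ 1)"
      by (simp add: x_def power2_eq_square field_simps)
    let ?v = "vector [of_real (A $ 1 $ 2), of_real (x - A $ 1 $ 1)] :: complex ^ 2"
    have "?v \<noteq> 0" using False by (simp add: vec_eq_iff forall_2)
    moreover have "cmatrix A *v ?v = of_real x *s ?v"
    proof -
      have "A $ 1 $ 1 * A $ 1 $ 2 + A $ 1 $ 2 * (x - A $ 1 $ 1) = x * A $ 1 $ 2"
        by (simp add: algebra_simps)
      with x have "complex_of_real (A $ 1 $ 1 * A $ 1 $ 2 + A $ 1 $ 2 * (x - A $ 1 $ 1)) = of_real (x * A $ 1 $ 2)"
        "complex_of_real (A $ 2 $ 1 * A $ 1 $ 2 + A $ 2 $ 2 * (x - A $ 1 $ 1)) = of_real (x * (x - A $ 1 $ 1))"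
        by simp_all
      thus ?thesis by (simp add: vec_eq_iff forall_2 matrix_vector_mult_2 map_matrix_def)
    qed
    ultimately show ?thesis unfolding spectrum_def by blast
  qed
  thus False using assms by auto
qed

text \<open>Both a left eigenvalue read off from \<open>\<tau>\<close> and an arbitrary element of the spectrum are nonreal roots
  of the characteristic polynomial; this identifies their modulus and real part without deciding
  which of the two conjugate roots they are.\<close>

lemma nonreal_root:
  fixes x :: complex and t D :: real
  assumes "x\<^sup>2 - of_real t * x + of_real D = 0" "Im x \<noteq> 0"
  shows "(cmod x)\<^sup>2 = D" "2 * Re x = t"
proof -
  have "Im (x\<^sup>2 - of_real t * x + of_real D) = 0" "Re (x\<^sup>2 - of_real t * x + of_real D) = 0"
    using assms by simp_all
  hence eq: "(2 * Re x - t) * Im x = 0" "(Re x)\<^sup>2 - (Im x)\<^sup>2 - t * Re x + D = 0"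
    by (simp_all add: power2_eq_square algebra_simps)
  thus t: "2 * Re x = t" using assms(2) by simp
  show "(cmod x)\<^sup>2 = D"
    using eq(2) unfolding cmod_power2 t[symmetric] by (simp add: power2_eq_square)
qed

lemma eigenvalue_invariants:
  fixes A :: "real ^ 2 ^ 2"
  assumes "spectrum A \<subseteq> UNIV - \<real>" "\<mu> \<in> spectrum A"
  shows "(cmod \<mu>)\<^sup>2 = det A" "2 * Re \<mu> = trace A"
proof -
  obtain v where v: "v \<noteq> 0" "cmatrix A *v v = \<mu> *s v" using assms(2) unfolding spectrum_def by blast
  define a b c d where "a = complex_of_real (A $ 1 $ 1)" and "b = complex_of_real (A $ 1 $ 2)"
    and "c = complex_of_real (A $ 2 $ 1)" and "d = complex_of_real (A $ 2 $ 2)"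
  have e1: "a * v $ 1 + b * v $ 2 = \<mu> * v $ 1" and e2: "c * v $ 1 + d * v $ 2 = \<mu> * v $ 2"
    using arg_cong[OF v(2), of "\<lambda>w. w $ 1"] arg_cong[OF v(2), of "\<lambda>w. w $ 2"]
    by (simp_all add: matrix_vector_mult_2 map_matrix_def a_def b_def c_def d_def)
  have "(\<mu>\<^sup>2 - (a + d) * \<mu> + (a * d - b * c)) * v $ 1 = 0"
    "(\<mu>\<^sup>2 - (a + d) * \<mu> + (a * d - b * c)) * v $ 2 = 0"
    using e1 e2 by algebra+
  hence "\<mu>\<^sup>2 - (a + d) * \<mu> + (a * d - b * c) = 0" using v(1) by (auto simp: vec_eq_iff forall_2)
  hence "\<mu>\<^sup>2 - of_real (trace A) * \<mu> + of_real (det A) = 0"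
    by (simp add: trace_def sum_2 det_2 a_def b_def c_def d_def)
  moreover have "Im \<mu> \<noteq> 0" using assms by (auto simp: complex_is_Real_iff)
  ultimately show "(cmod \<mu>)\<^sup>2 = det A" "2 * Re \<mu> = trace A" by (rule nonreal_root)+
qed

text \<open>The condition that the row vector \<open>(1, \<tau>)\<close> is a left eigenvector of \<open>A\<close>, for the eigenvalue
  \<open>A $ 1 $ 1 + \<tau> * A $ 2 $ 1\<close>, after elimination of the eigenvalue.\<close>

definition eigenslope :: "complex \<Rightarrow> real ^ 2 ^ 2 \<Rightarrow> bool" where
  "eigenslope \<tau> A \<longleftrightarrow>
     of_real (A $ 2 $ 1) * \<tau>\<^sup>2 + of_real (A $ 1 $ 1 - A $ 2 $ 2) * \<tau> - of_real (A $ 1 $ 2) = 0"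

lemma exists_eigenslope:
  fixes A :: "real ^ 2 ^ 2"
  assumes "(A $ 1 $ 1 - A $ 2 $ 2)\<^sup>2 + 4 * A $ 1 $ 2 * A $ 2 $ 1 < 0"
  obtains \<tau> where "Im \<tau> \<noteq> 0" "eigenslope \<tau> A"
proof -
  define e where "e = A $ 1 $ 1 - A $ 2 $ 2"
  define s where "s = sqrt (- (e\<^sup>2 + 4 * A $ 1 $ 2 * A $ 2 $ 1))"
  define \<tau> where "\<tau> = Complex (- e / (2 * A $ 2 $ 1)) (s / (2 * A $ 2 $ 1))"
  have s: "s > 0" "s\<^sup>2 = - (e\<^sup>2 + 4 * A $ 1 $ 2 * A $ 2 $ 1)" using assms by (auto simp: s_def e_def)
  have c: "A $ 2 $ 1 \<noteq> 0"
  proof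
    assume "A $ 2 $ 1 = 0"
    thus False using assms zero_le_power2[of "A $ 1 $ 1 - A $ 2 $ 2"] by simp
  qed
  have "Im \<tau> \<noteq> 0" using s c by (simp add: \<tau>_def)
  moreover have "eigenslope \<tau> A"
  proof -
    have "2 * of_real (A $ 2 $ 1) * \<tau> + of_real e = \<i> * of_real s"
      using c by (simp add: \<tau>_def complex_eq_iff)
    moreover have "complex_of_real (s\<^sup>2) = - (of_real e ^ 2 + 4 * of_real (A $ 1 $ 2) * of_real (A $ 2 $ 1))"
      unfolding s(2) by simp
    hence "complex_of_real s ^ 2 = - (of_real e ^ 2 + 4 * of_real (A $ 1 $ 2) * of_real (A $ 2 $ 1))" by simp
    moreover have "\<i> ^ 2 = -1" by simp
    ultimately have "4 * of_real (A $ 2 $ 1) *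
        (of_real (A $ 2 $ 1) * \<tau>\<^sup>2 + of_real e * \<tau> - of_real (A $ 1 $ 2)) = 0" by algebra
    thus ?thesis using c by (simp add: eigenslope_def e_def)
  qed
  ultimately show ?thesis using that by blast
qed

text \<open>The determinant of the commutator is, up to sign, the resultant of the two quadratic polynomials
  that define the eigenslopes. A negative discriminant makes the quadratic form of \<open>A\<close> definite, and
  with the linear relation between \<open>X\<close>, \<open>Y\<close>, \<open>Z\<close> this forces \<open>X = Z = 0\<close>: the polynomials are
  proportional.\<close>

lemma eigenslope_common:
  fixes A B :: "real ^ 2 ^ 2"
  assumes A: "(A $ 1 $ 1 - A $ 2 $ 2)\<^sup>2 + 4 * A $ 1 $ 2 * A $ 2 $ 1 < 0"
    and det: "det (commutator A B) = 0" and \<tau>: "eigenslope \<tau> A"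
  shows "eigenslope \<tau> B"
proof -
  define b c e where "b = A $ 1 $ 2" and "c = A $ 2 $ 1" and "e = A $ 1 $ 1 - A $ 2 $ 2"
  define b' c' e' where "b' = B $ 1 $ 2" and "c' = B $ 2 $ 1" and "e' = B $ 1 $ 1 - B $ 2 $ 2"
  define X Y Z where "X = b * c' - b' * c" and "Y = e * b' - e' * b" and "Z = c * e' - c' * e"
  have neg: "e\<^sup>2 + 4 * b * c < 0" using A by (simp add: e_def b_def c_def)
  have "det (commutator A B) = - (X\<^sup>2 + Y * Z)"
    by (simp add: det_2 commutator_def matrix_matrix_mult_def sum_2 X_def Y_def Z_def
        b_def c_def e_def b'_def c'_def e'_def power2_eq_square algebra_simps)
  hence XYZ: "X\<^sup>2 + Y * Z = 0" using det by simp
  have lin: "c * Y + e * X + b * Z = 0" by (simp add: X_def Y_def Z_def algebra_simps)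
  have c0: "c \<noteq> 0"
  proof
    assume "c = 0" thus False using neg zero_le_power2[of e] by simp
  qed
  have definite: "u = 0 \<and> v = 0" if "c * u\<^sup>2 + e * u * v - b * v\<^sup>2 = 0" for u v :: real
  proof -
    have "(2 * c * u + e * v)\<^sup>2 = (e\<^sup>2 + 4 * b * c) * v\<^sup>2"
      using that by algebra
    moreover have "(e\<^sup>2 + 4 * b * c) * v\<^sup>2 \<le> 0" using neg by (simp add: mult_nonpos_nonneg)
    ultimately have "(2 * c * u + e * v)\<^sup>2 = 0" "(e\<^sup>2 + 4 * b * c) * v\<^sup>2 = 0"
      using zero_le_power2[of "2 * c * u + e * v"] by linarith+
    thus ?thesis using neg c0 by auto
  qed
  have "c * Y\<^sup>2 + e * Y * X - b * X\<^sup>2 = 0" using lin XYZ by algebra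
  hence "X = 0" using definite by blast
  moreover have "c * X\<^sup>2 + e * X * (- Z) - b * (- Z)\<^sup>2 = 0" using lin XYZ by algebra
  hence "Z = 0" using definite by fastforce
  ultimately have eqs: "b * c' = b' * c" "c * e' = c' * e" by (simp_all add: X_def Z_def)
  have "of_real c * (of_real c' * \<tau>\<^sup>2 + of_real e' * \<tau> - of_real b') =
      of_real c' * (of_real c * \<tau>\<^sup>2 + of_real e * \<tau> - of_real b)"
    using arg_cong[OF eqs(1), of complex_of_real] arg_cong[OF eqs(2), of complex_of_real]
    by (simp only: of_real_mult) algebra
  also have "\<dots> = 0" using \<tau> by (simp add: eigenslope_def b_def c_def e_def)
  finally show ?thesis using c0 by (simp add: eigenslope_def b'_def c'_def e'_def)
qed

lemma eigenslope_cnj: "eigenslope \<tau> A \<Longrightarrow> eigenslope (cnj \<tau>) A"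
  unfolding eigenslope_def
  by (drule arg_cong[where f = cnj]) simp

lemma coord_image:
  assumes "eigenslope \<tau> A"
  shows "coord \<tau> ((cmatrix A + mat \<i>) *v x) = (of_real (A $ 1 $ 1) + \<tau> * of_real (A $ 2 $ 1) + \<i>) * coord \<tau> x"
proof -
  have key: "(a + \<i>) * x1 + b * x2 + \<tau> * (c * x1 + (d + \<i>) * x2) = (a + \<tau> * c + \<i>) * (x1 + \<tau> * x2)"
    if "c * \<tau>\<^sup>2 + (a - d) * \<tau> - b = 0" for a b c d x1 x2
  proof -
    have key: "(a + \<i>) * x1 + b * x2 + \<tau> * (c * x1 + (d + \<i>) * x2) - (a + \<tau> * c + \<i>) * (x1 + \<tau> * x2)
        = - x2 * (c * \<tau>\<^sup>2 + (a - d) * \<tau> - b)"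
      by (simp add: algebra_simps power2_eq_square)
    also have "\<dots> = 0" using that by simp
    finally show ?thesis by simp
  qed
  have "coord \<tau> ((cmatrix A + mat \<i>) *v x) = (of_real (A $ 1 $ 1) + \<i>) * x $ 1 + of_real (A $ 1 $ 2) * x $ 2 +
      \<tau> * (of_real (A $ 2 $ 1) * x $ 1 + (of_real (A $ 2 $ 2) + \<i>) * x $ 2)"
    by (simp add: coord_def matrix_vector_mult_2 map_matrix_def mat_def)
  also have "\<dots> = (of_real (A $ 1 $ 1) + \<tau> * of_real (A $ 2 $ 1) + \<i>) * (x $ 1 + \<tau> * x $ 2)"
    by (rule key[OF assms[unfolded eigenslope_def of_real_diff]])
  finally show ?thesis by (simp only: coord_def)
qed

lemma range_cvec_eq_plane:
  assumes "Im \<tau> \<noteq> 0"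
  shows "range cvec = plane \<tau> 1"
proof (intro equalityI subsetI)
  fix z :: "complex ^ 2" assume "z \<in> range cvec"
  thus "z \<in> plane \<tau> 1" by (auto simp: cvec_def plane_def coord_def)
next
  fix z assume "z \<in> plane \<tau> 1"
  hence eq: "z $ 1 + cnj \<tau> * z $ 2 = cnj (z $ 1) + cnj \<tau> * cnj (z $ 2)"
    by (simp add: plane_def coord_def)
  have "Im \<tau> * Im (z $ 2) = 0" using arg_cong[OF eq, of Re] by simp
  hence "Im (z $ 2) = 0" using assms by simp
  moreover from this have "Im (z $ 1) = 0" using arg_cong[OF eq, of Im] by simp
  ultimately have "z = cvec (\<chi> i. Re (z $ i))" by (simp add: cvec_def vec_eq_iff forall_2 complex_eq_iff)
  thus "z \<in> range cvec" by blast
qed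

text \<open>In the eigencoordinates, \<open>A + \<i>\<close> multiplies by \<open>l + \<i>\<close> and \<open>cnj l + \<i>\<close>, where \<open>l\<close> is the left
  eigenvalue, and real vectors have conjugate coordinates. This gives the slope
  \<open>c = (cnj l + \<i>) / (cnj l - \<i>)\<close>. Multiplying numerator and denominator by \<open>l + \<i>\<close> shows that \<open>c\<close> is a
  positive multiple of \<open>\<bar>l\<bar>\<^sup>2 - 1 + 2 \<i> Re l\<close>.\<close>

lemma M_eq_plane:
  fixes A :: "real ^ 2 ^ 2"
  assumes \<tau>: "Im \<tau> \<noteq> 0" "eigenslope \<tau> A"
    and inv: "invertible (cmatrix A + mat \<i>)" and c0: "A $ 2 $ 1 \<noteq> 0"
  obtains c r where "M A = plane \<tau> c" "c \<noteq> 0" "c \<noteq> 1" "r > 0"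
    "Complex (det A - 1) (trace A) = of_real r * c"
proof -
  define l where "l = of_real (A $ 1 $ 1) + \<tau> * of_real (A $ 2 $ 1)"
  let ?B = "cmatrix A + mat \<i>"
  have im: "coord \<tau> (?B *v x) = (l + \<i>) * coord \<tau> x" for x
    using coord_image[OF \<tau>(2)] by (simp add: l_def)
  have im': "coord (cnj \<tau>) (?B *v x) = (cnj l + \<i>) * coord (cnj \<tau>) x" for x
    using coord_image[OF eigenslope_cnj[OF \<tau>(2)]] by (simp add: l_def)
  obtain B' where "?B ** B' = mat 1" using inv unfolding invertible_def by blast
  hence "?B *v (B' *v y) = y" for y by (simp add: matrix_vector_mul_assoc)
  hence "coord \<tau> (vector [1, 0]) = (l + \<i>) * coord \<tau> (B' *v vector [1, 0])"
    "coord (cnj \<tau>) (vector [1, 0]) = (cnj l + \<i>) * coord (cnj \<tau>) (B' *v vector [1, 0])"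
    using im im' by metis+
  hence l: "l + \<i> \<noteq> 0" "cnj l + \<i> \<noteq> 0" by (auto simp: coord_def)
  have cl: "cnj (l + \<i>) = cnj l - \<i>" by simp
  have l': "cnj l - \<i> \<noteq> 0" using l(1) unfolding cl[symmetric] by (simp del: complex_cnj_add)
  define c where "c = (cnj l + \<i>) / (cnj l - \<i>)"
  have "M A = plane \<tau> c"
  proof (intro equalityI subsetI)
    fix z assume "z \<in> M A"
    then obtain x where x: "z = ?B *v cvec x" by (auto simp: M_def)
    have "coord (cnj \<tau>) (cvec x) = cnj (coord \<tau> (cvec x))" by (simp add: coord_def cvec_def)
    thus "z \<in> plane \<tau> c" using l' by (simp add: plane_def x im im' c_def)
  next
    fix z assume z: "z \<in> plane \<tau> c"
    define w where "w = coord \<tau> z / (l + \<i>)"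
    have "point \<tau> w (cnj w) \<in> plane \<tau> 1" by (simp add: plane_def coord_point[OF \<tau>(1)])
    then obtain x where x: "point \<tau> w (cnj w) = cvec x" using range_cvec_eq_plane[OF \<tau>(1)] by blast
    have "z = ?B *v cvec x"
    proof (rule coords_eqI[OF \<tau>(1)])
      show "coord \<tau> z = coord \<tau> (?B *v cvec x)"
        using l by (simp add: im flip: x) (simp add: coord_point[OF \<tau>(1)] w_def)
      show "coord (cnj \<tau>) z = coord (cnj \<tau>) (?B *v cvec x)"
        using z l' by (simp add: im' plane_def flip: x)
          (simp add: coord_point[OF \<tau>(1)] w_def c_def)
    qed
    thus "z \<in> M A" by (auto simp: M_def)
  qed
  moreover have "c \<noteq> 0" using l l' by (simp add: c_def)
  moreover have "c \<noteq> 1" using l' by (simp add: c_def complex_eq_iff[of "cnj l + \<i>"])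
  moreover have "(cmod (l + \<i>))\<^sup>2 > 0" using l by simp
  moreover have "Complex (det A - 1) (trace A) = of_real ((cmod (l + \<i>))\<^sup>2) * c"
  proof -
    have "l\<^sup>2 - of_real (trace A) * l + of_real (det A) = of_real (A $ 2 $ 1) *
      (of_real (A $ 2 $ 1) * \<tau>\<^sup>2 + of_real (A $ 1 $ 1 - A $ 2 $ 2) * \<tau> - of_real (A $ 1 $ 2))"
      by (simp add: l_def trace_def sum_2 det_2 power2_eq_square algebra_simps)
    also have "\<dots> = 0" using \<tau>(2) by (simp add: eigenslope_def)
    finally have "(cmod l)\<^sup>2 = det A" "2 * Re l = trace A"
      using nonreal_root[of l "trace A" "det A"] \<tau>(1) c0 by (simp_all add: l_def)
    hence "(Re l)\<^sup>2 + (Im l)\<^sup>2 = det A" "trace A = 2 * Re l" by (simp_all add: cmod_power2)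
    hence "Complex (det A - 1) (trace A) = (l + \<i>) * (cnj l + \<i>)"
      by (simp add: complex_eq_iff power2_eq_square algebra_simps)
    also have "\<dots> = of_real ((cmod (l + \<i>))\<^sup>2) * c"
      using l' unfolding complex_norm_square cl by (simp add: c_def)
    finally show ?thesis .
  qed
  ultimately show ?thesis using that by blast
qed

theorem corollary1p5:
  fixes m :: nat
    and A :: "nat \<Rightarrow> real ^ 2 ^ 2"
    and \<mu> :: "nat \<Rightarrow> complex"
  assumes "\<And>j. j \<in> {1..m} \<Longrightarrow> invertible (cmatrix (A j) + mat \<i>)"
    and "\<And>j k. j \<in> {1..m} \<Longrightarrow> k \<in> {1..m} \<Longrightarrow> j \<noteq> k \<Longrightarrow> M (A j) \<inter> M (A k) = {0}"
    and "\<And>j. j \<in> {1..m} \<Longrightarrow> spectrum (A j) \<subseteq> UNIV - \<real>"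
    and "\<And>j k. 1 \<le> j \<Longrightarrow> j < k \<Longrightarrow> k \<le> m \<Longrightarrow> det (commutator (A j) (A k)) = 0"
    and "\<And>j. j \<in> {1..m} \<Longrightarrow> \<mu> j \<in> spectrum (A j)"
  shows "allows_Carleman_approximation ((\<Union>j\<in>{1..m}. M (A j)) \<union> range cvec)
    \<longleftrightarrow> \<not> (\<exists>j k. j < k \<and> k \<le> m \<and> (\<exists>c>0. V \<mu> j = c *\<^sub>R V \<mu> k))"
proof -
  note disc = discriminant_neg_of_nonreal_spectrum[OF assms(3)]
  obtain \<tau> where \<tau>: "Im \<tau> \<noteq> 0" "\<And>j. j \<in> {1..m} \<Longrightarrow> eigenslope \<tau> (A j)"
  proof (cases "m = 0")
    case True
    thus ?thesis using that[of \<i>] by simp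
  next
    case False
    then obtain \<tau> where "Im \<tau> \<noteq> 0" "eigenslope \<tau> (A 1)"
      using exists_eigenslope[OF disc[of 1]] by auto
    moreover from this have "eigenslope \<tau> (A j)" if "j \<in> {1..m}" for j
      using that False eigenslope_common[OF disc[of 1] assms(4)[of 1 j]] by (cases "j = 1") auto
    ultimately show ?thesis using that by blast
  qed
  have "\<exists>c r. M (A j) = plane \<tau> c \<and> c \<noteq> 0 \<and> c \<noteq> 1 \<and> r > 0 \<and>
      Complex (det (A j) - 1) (trace (A j)) = of_real r * c" if j: "j \<in> {1..m}" for j
  proof -
    have "A j $ 2 $ 1 \<noteq> 0"
    proof
      assume "A j $ 2 $ 1 = 0"
      thus False using disc[OF j] zero_le_power2[of "A j $ 1 $ 1 - A j $ 2 $ 2"] by simp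
    qed
    from M_eq_plane[OF \<tau>(1) \<tau>(2)[OF j] assms(1)[OF j] this] show ?thesis by metis
  qed
  then obtain c' r' where cr': "\<And>j. j \<in> {1..m} \<Longrightarrow> M (A j) = plane \<tau> (c' j) \<and> c' j \<noteq> 0 \<and> c' j \<noteq> 1 \<and>
      r' j > 0 \<and> Complex (det (A j) - 1) (trace (A j)) = of_real (r' j) * c' j" by metis
  define c where "c = (\<lambda>j. if j = 0 then 1 else c' j)"
  define r where "r = (\<lambda>j. if j = 0 then 1 else r' j)"
  have S_eq: "(\<Union>j\<in>{1..m}. M (A j)) \<union> range cvec = (\<Union>j\<in>{..m}. plane \<tau> (c j))"
  proof -
    have "{..m} = insert 0 {1..m}" by auto
    moreover have "(\<Union>j\<in>{1..m}. M (A j)) = (\<Union>j\<in>{1..m}. plane \<tau> (c j))"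
      using cr' by (intro SUP_cong) (auto simp: c_def)
    ultimately show ?thesis using range_cvec_eq_plane[OF \<tau>(1)] by (auto simp: c_def)
  qed
  have c0: "c j \<noteq> 0" and r0: "r j > 0" if "j \<le> m" for j
    using that cr'[of j] by (auto simp: c_def r_def)
  have V: "Complex (V \<mu> j $ 1) (V \<mu> j $ 2) = of_real (r j) * c j" if "j \<le> m" for j
    using that cr'[of j] eigenvalue_invariants[OF assms(3,5), of j]
    by (cases "j = 0") (auto simp: V_def c_def r_def complex_eq_iff)
  have c_inj: "c j \<noteq> c k" if "j < k" "k \<le> m" for j k
  proof
    assume eq: "c j = c k"
    show False
    proof (cases "j = 0")
      case True
      thus False using eq cr'[of k] that by (auto simp: c_def)
    next
      case False
      hence "plane \<tau> (c k) = {0}" using assms(2)[of j k] that cr'[of j] cr'[of k] eq by (auto simp: c_def)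
      moreover have "point \<tau> 1 (c k) \<in> plane \<tau> (c k)" by (simp add: plane_def coord_point[OF \<tau>(1)])
      ultimately have "point \<tau> 1 (c k) = 0" by auto
      thus False using coord_point(1)[OF \<tau>(1), of 1 "c k"] by simp
    qed
  qed
  (* V j and c j differ by the positive factor r j only. *)
  have V_iff: "(\<exists>t>0. V \<mu> j = t *\<^sub>R V \<mu> k) \<longleftrightarrow> (\<exists>t>0. c j = of_real t * c k)"
    if jk: "j \<le> m" "k \<le> m" for j k
  proof -
    have "V \<mu> j = t *\<^sub>R V \<mu> k \<longleftrightarrow> c j = of_real (t * r k / r j) * c k" for t
    proof -
      have "V \<mu> j = t *\<^sub>R V \<mu> k \<longleftrightarrow>
          Complex (V \<mu> j $ 1) (V \<mu> j $ 2) = of_real t * Complex (V \<mu> k $ 1) (V \<mu> k $ 2)"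
        by (simp add: vec_eq_iff forall_2 complex_eq_iff)
      also have "\<dots> \<longleftrightarrow> c j = of_real (t * r k / r j) * c k"
        unfolding V[OF jk(1)] V[OF jk(2)] using r0[OF jk(1)] by (auto simp: field_simps)
      finally show ?thesis .
    qed
    note scale = this
    show ?thesis
    proof
      assume "\<exists>t>0. V \<mu> j = t *\<^sub>R V \<mu> k"
      then obtain t where "t > 0" "V \<mu> j = t *\<^sub>R V \<mu> k" by blast
      thus "\<exists>t>0. c j = of_real t * c k"
        using scale[of t] r0 jk by (intro exI[of _ "t * r k / r j"]) simp
    next
      assume "\<exists>t>0. c j = of_real t * c k"
      then obtain t where "t > 0" "c j = of_real t * c k" by blast
      thus "\<exists>t>0. V \<mu> j = t *\<^sub>R V \<mu> k"
        using scale[of "t * r j / r k"] r0[OF jk(1)] r0[OF jk(2)]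
        by (intro exI[of _ "t * r j / r k"]) simp
    qed
  qed
  show ?thesis
    unfolding S_eq
  proof (intro iffI notI)
    assume "allows_Carleman_approximation (\<Union>j\<in>{..m}. plane \<tau> (c j))"
      and "\<exists>j k. j < k \<and> k \<le> m \<and> (\<exists>t>0. V \<mu> j = t *\<^sub>R V \<mu> k)"
    moreover from this obtain j k t where jk: "j < k" "k \<le> m" "t > 0" "c j = of_real t * c k"
      using V_iff by (metis less_imp_le_nat order.trans)
    moreover have "plane \<tau> (c j) \<subseteq> (\<Union>j\<in>{..m}. plane \<tau> (c j))"
      "plane \<tau> (c k) \<subseteq> (\<Union>j\<in>{..m}. plane \<tau> (c j))"
      by (rule UN_upper, use jk in simp)+
    ultimately show False
      using not_Carleman_same_ray[OF \<tau>(1) jk(4,3) c_inj[OF jk(1,2)]] by blast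
  next
    assume no: "\<not> (\<exists>j k. j < k \<and> k \<le> m \<and> (\<exists>t>0. V \<mu> j = t *\<^sub>R V \<mu> k))"
    have no_ray: "sgn (c j) \<noteq> sgn (c k)" if "j < k" "k \<le> m" for j k
    proof
      assume eq: "sgn (c j) = sgn (c k)"
      have nz: "c j \<noteq> 0" "c k \<noteq> 0" using c0 that by auto
      have "c j = of_real (cmod (c j)) * sgn (c j)" using nz by (simp add: sgn_eq)
      also have "\<dots> = of_real (cmod (c j) / cmod (c k)) * c k" unfolding eq by (simp add: sgn_eq)
      finally have "\<exists>t>0. c j = of_real t * c k"
        using nz by (intro exI[of _ "cmod (c j) / cmod (c k)"]) simp
      thus False using no V_iff[of j k] that by auto
    qed
    interpret pencil \<tau> "c ` {..m}"
    proof
      show "inj_on sgn (c ` {..m})"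
      proof (rule inj_onI)
        fix x y assume "x \<in> c ` {..m}" "y \<in> c ` {..m}" and eq: "sgn x = sgn y"
        then obtain j k where jk: "j \<le> m" "k \<le> m" "x = c j" "y = c k" by auto
        have "j = k"
        proof (rule ccontr)
          assume "j \<noteq> k"
          hence "j < k \<or> k < j" by auto
          thus False using no_ray[of j k] no_ray[of k j] jk eq by auto
        qed
        thus "x = y" using jk by simp
      qed
    qed (use \<tau> c0 in auto)
    show "allows_Carleman_approximation (\<Union>j\<in>{..m}. plane \<tau> (c j))"
      using Carleman_approximation unfolding S_def by simp
  qed
qed

end
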